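(* Let $(E_1,E_2)$ and $(X_1,X_2)$ be pairs of a Banach space and a subspace, with $E_1$ finite-dimensional. Then $\mathcal{L}(E_1,E_2;X_1,X_2)^{**}$ is isometrically isomorphic to $\mathcal{L}(E_1,E_2;X_1^{**},X_2^{**})$, the identification being given by $$\varphi\mapsto\tilde\varphi,\qquad \tilde\varphi: e\mapsto\big[x^*\mapsto \varphi(e\otimes x^* )\big]\qquad (e\in E_1,\ x^*\in X_1^* ).$$
   Context: A pair of a Banach space and a subspace $(X_1,X_2)$ consists of a Banach space $X_1$ and a closed subspace $X_2\subseteq X_1$. For such pairs, $\mathcal{L}(E_1,E_2;X_1,X_2)=\{S\in\mathcal{L}(E_1;X_1): S(E_2)\subseteq X_2\}$, a closed subspace of the space $\mathcal{L}(E_1;X_1)$ of bounded linear maps with the operator norm. The bidual $X_2^{**}$ is regarded as a closed subspace of $X_1^{**}$ via the canonical inclusion, i.e. it is identified with $X_2^{\perp\perp}\subseteq X_1^{**}$. For $e\in E_1$ and $x^*\in X_1^*$, $e\otimes x^*$ denotes the bounded linear functional $S\mapsto x^*(Se)$ (on $\mathcal{L}(E_1;X_1)$ and, by restriction, on $\mathcal{L}(E_1,E_2;X_1,X_2)$). *)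

theory Defs
  imports "HOL-Analysis.Analysis" "HOL-Library.Function_Algebras"
begin

text \<open>
  The library's type class of Banach spaces covers real scalars only, and neither the dual of a
  subspace nor the space of operators respecting a subspace is a type. Normed spaces are therefore
  represented by records over a scalar field that is either the reals or the complex numbers.
  The carrier is a linear subspace of an ambient vector space, whose addition is that of the type
  (pointwise for functions).
\<close>

class real_or_complex = real_normed_field +
  assumes real_or_complex:
    "(\<forall>z. \<exists>a. z = a *\<^sub>R 1) \<or>
     (\<exists>i. i * i = - 1 \<and>
       (\<forall>z. \<exists>a b. z = a *\<^sub>R 1 + b *\<^sub>R i \<and> norm z = sqrt (a\<^sup>2 + b\<^sup>2)))"

instance real :: real_or_complex
  by standard simp

instance complex :: real_or_complex
proof
  have "\<exists>a b. z = a *\<^sub>R 1 + b *\<^sub>R \<i> \<and> cmod z = sqrt (a\<^sup>2 + b\<^sup>2)" for z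
    by (rule exI[of _ "Re z"], rule exI[of _ "Im z"]) (simp add: complex_eq_iff cmod_def)
  then show "(\<forall>z::complex. \<exists>a. z = a *\<^sub>R 1) \<or>
     (\<exists>i::complex. i * i = - 1 \<and>
       (\<forall>z. \<exists>a b. z = a *\<^sub>R 1 + b *\<^sub>R i \<and> norm z = sqrt (a\<^sup>2 + b\<^sup>2)))"
    by (intro disjI2 exI[of _ \<i>]) simp
qed

record ('k, 'a) nspace =
  car :: "'a set"
  smul :: "'k \<Rightarrow> 'a \<Rightarrow> 'a"
  nrm :: "'a \<Rightarrow> real"

definition dst :: "('k, 'a::ab_group_add) nspace \<Rightarrow> 'a \<Rightarrow> 'a \<Rightarrow> real"
  where "dst N x y = nrm N (x - y)"

locale normed_space = vector_space "smul N"
  for N :: "('k::real_or_complex, 'a::ab_group_add) nspace" +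
  assumes subspace_car: "subspace (car N)"
    and nrm_eq_0_iff: "x \<in> car N \<Longrightarrow> nrm N x = 0 \<longleftrightarrow> x = 0"
    and nrm_smul: "x \<in> car N \<Longrightarrow> nrm N (smul N c x) = norm c * nrm N x"
    and nrm_triangle: "\<lbrakk>x \<in> car N; y \<in> car N\<rbrakk> \<Longrightarrow> nrm N (x + y) \<le> nrm N x + nrm N y"

locale banach_space = normed_space +
  assumes complete: "Metric_space.mcomplete (car N) (dst N)"

definition closed_subspace ::
    "('k::real_or_complex, 'a::ab_group_add) nspace \<Rightarrow> 'a set \<Rightarrow> bool"
  where "closed_subspace N V \<longleftrightarrow>
    module.subspace (smul N) V \<and> closedin (Metric_space.mtopology (car N) (dst N)) V"

definition finite_dimensional_space ::
    "('k::real_or_complex, 'a::ab_group_add) nspace \<Rightarrow> bool"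
  where "finite_dimensional_space N \<longleftrightarrow> (\<exists>B. finite B \<and> module.span (smul N) B = car N)"

text \<open>
  Maps defined on a carrier are made unique as functions on the whole type by the value 0 outside
  the carrier; this keeps them closed under the pointwise operations.
\<close>

definition bounded_operators ::
    "('k::real_or_complex, 'a::ab_group_add) nspace \<Rightarrow> ('k, 'b::ab_group_add) nspace \<Rightarrow>
      ('a \<Rightarrow> 'b) set"
  where "bounded_operators N M = {T.
    (\<forall>x\<in>car N. T x \<in> car M) \<and>
    (\<forall>x\<in>car N. \<forall>y\<in>car N. T (x + y) = T x + T y) \<and>
    (\<forall>c. \<forall>x\<in>car N. T (smul N c x) = smul M c (T x)) \<and>
    (\<exists>K. \<forall>x\<in>car N. nrm M (T x) \<le> K * nrm N x) \<and>
    (\<forall>x. x \<notin> car N \<longrightarrow> T x = 0)}"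

definition operator_space ::
    "('k::real_or_complex, 'a::ab_group_add) nspace \<Rightarrow> ('k, 'b::ab_group_add) nspace \<Rightarrow>
      ('k, 'a \<Rightarrow> 'b) nspace"
  where "operator_space N M =
    \<lparr>car = bounded_operators N M,
     smul = (\<lambda>c T x. smul M c (T x)),
     nrm = (\<lambda>T. SUP x\<in>{x \<in> car N. nrm N x \<le> 1}. nrm M (T x))\<rparr>"

definition pair_operator_space ::
    "('k::real_or_complex, 'a::ab_group_add) nspace \<Rightarrow> 'a set \<Rightarrow>
      ('k, 'b::ab_group_add) nspace \<Rightarrow> 'b set \<Rightarrow> ('k, 'a \<Rightarrow> 'b) nspace"
  where "pair_operator_space N V M W =
    (operator_space N M)\<lparr>car := {S \<in> bounded_operators N M. S ` V \<subseteq> W}\<rparr>"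

definition scalar_space :: "('k::real_or_complex, 'k) nspace"
  where "scalar_space = \<lparr>car = UNIV, smul = (*), nrm = norm\<rparr>"

definition dual :: "('k::real_or_complex, 'a::ab_group_add) nspace \<Rightarrow> ('k, 'a \<Rightarrow> 'k) nspace"
  where "dual N = operator_space N scalar_space"

abbreviation bidual ::
    "('k::real_or_complex, 'a::ab_group_add) nspace \<Rightarrow> ('k, ('a \<Rightarrow> 'k) \<Rightarrow> 'k) nspace"
  where "bidual N \<equiv> dual (dual N)"

definition annihilator ::
    "('k::real_or_complex, 'a::ab_group_add) nspace \<Rightarrow> 'a set \<Rightarrow> ('a \<Rightarrow> 'k) set"
  where "annihilator N V = {f \<in> car (dual N). \<forall>x\<in>V. f x = 0}"

text \<open>The bidual of a subspace, viewed inside the bidual of the whole space.\<close>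

definition biannihilator ::
    "('k::real_or_complex, 'a::ab_group_add) nspace \<Rightarrow> 'a set \<Rightarrow> (('a \<Rightarrow> 'k) \<Rightarrow> 'k) set"
  where "biannihilator N V = annihilator (dual N) (annihilator N V)"

text \<open>The functional \<open>e \<otimes> f\<close>, restricted to the subspace \<open>L\<close> of operators.\<close>

definition tensor_functional ::
    "('k::real_or_complex, 'a \<Rightarrow> 'b) nspace \<Rightarrow> 'a \<Rightarrow> ('b \<Rightarrow> 'k) \<Rightarrow> (('a \<Rightarrow> 'b) \<Rightarrow> 'k)"
  where "tensor_functional L e f = (\<lambda>S. if S \<in> car L then f (S e) else 0)"

definition tilde ::
    "('k::real_or_complex, 'a::ab_group_add) nspace \<Rightarrow> ('k, 'b::ab_group_add) nspace \<Rightarrow>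
      ('k, 'a \<Rightarrow> 'b) nspace \<Rightarrow> ((('a \<Rightarrow> 'b) \<Rightarrow> 'k) \<Rightarrow> 'k) \<Rightarrow> ('a \<Rightarrow> (('b \<Rightarrow> 'k) \<Rightarrow> 'k))"
  where "tilde N M L \<phi> =
    (\<lambda>e. if e \<in> car N
          then (\<lambda>f. if f \<in> car (dual M) then \<phi> (tensor_functional L e f) else 0)
          else 0)"

definition isometric_isomorphism ::
    "('k::real_or_complex, 'a::ab_group_add) nspace \<Rightarrow> ('k, 'b::ab_group_add) nspace \<Rightarrow>
      ('a \<Rightarrow> 'b) \<Rightarrow> bool"
  where "isometric_isomorphism N M \<Phi> \<longleftrightarrow>
    bij_betw \<Phi> (car N) (car M) \<and>
    (\<forall>x\<in>car N. \<forall>y\<in>car N. \<Phi> (x + y) = \<Phi> x + \<Phi> y) \<and>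
    (\<forall>c. \<forall>x\<in>car N. \<Phi> (smul N c x) = smul M c (\<Phi> x)) \<and>
    (\<forall>x\<in>car N. nrm M (\<Phi> x) = nrm N x)"

text \<open>Banach spaces in the sense of the library are instances, with real scalars.\<close>

lemma banach_space_of_class:
  "banach_space \<lparr>car = UNIV, smul = scaleR, nrm = (norm :: 'a::banach \<Rightarrow> real)\<rparr>"
    (is "banach_space ?N")
proof -
  have d: "dst ?N = dist"
    by (simp add: dst_def fun_eq_iff dist_norm)
  have "vector_space (scaleR :: real \<Rightarrow> 'a \<Rightarrow> 'a)"
    by unfold_locales (simp_all add: scaleR_add_right scaleR_add_left)
  moreover have "module.subspace (scaleR :: real \<Rightarrow> 'a \<Rightarrow> 'a) UNIV"
    using subspace_UNIV[where 'a = 'a] by (simp add: subspace_raw_def)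
  moreover have "Metric_space.mcomplete (UNIV :: 'a set) dist"
    by (metis mcomplete_iff_complete complete_UNIV)
  ultimately show ?thesis
    by (simp add: banach_space_def banach_space_axioms_def normed_space_def
        normed_space_axioms_def d norm_triangle_ineq)
qed

end

theory Submission
  imports Defs
begin

text \<open>
  Let \<open>L\<close> be the space of operators \<open>S\<close> from \<open>E\<^sub>1\<close> to \<open>X\<^sub>1\<close> that map \<open>E\<^sub>2\<close> into \<open>X\<^sub>2\<close>. The theorem
  holds because every functional on \<open>L\<close> is a finite sum of elementary tensors \<open>e \<otimes> x\<^sup>*\<close>, and this
  with almost no loss in norm. The reason is that \<open>E\<^sub>1\<close> has finite dimension: an operator is
  controlled by its values on a finite set \<open>A\<close>, so that \<open>L\<close> embeds into the finite families
  \<open>A \<rightarrow> X\<^sub>1\<close> with the maximum norm. A functional on \<open>L\<close> extends to all families by the Hahn--Banach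
  theorem, and there it is a sum of functionals of the entries
  (\<open>functional_as_sum_of_evaluations\<close>).

  That the transform of \<open>\<phi>\<close> has at most the norm of \<open>\<phi>\<close> follows from
  \<open>\<parallel>e \<otimes> x\<^sup>*\<parallel> \<le> \<parallel>e\<parallel> \<parallel>x\<^sup>*\<parallel>\<close>. It maps \<open>E\<^sub>2\<close> into the biannihilator of \<open>X\<^sub>2\<close> because \<open>e \<otimes> x\<^sup>*\<close>
  vanishes on \<open>L\<close> if \<open>e \<in> E\<^sub>2\<close> and \<open>x\<^sup>*\<close> annihilates \<open>X\<^sub>2\<close>. For the reverse inequality the finite
  set is a fine net of the unit ball of \<open>E\<^sub>1\<close>: for it the embedding is almost isometric, and the
  sums of tensors have almost optimal norm (\<open>nrm_le_tilde\<close>). Linearity and isometry give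
  injectivity.

  For surjectivity (\<open>tilde_surjective\<close>) the finite set is a basis of \<open>E\<^sub>1\<close> that extends a basis of
  \<open>E\<^sub>2\<close>. Given \<open>T\<close>, the functional \<open>\<Sum>b. b \<otimes> y b\<close> must be mapped to \<open>\<Sum>b. T b (y b)\<close>. The only freedom
  in \<open>y\<close> is to change \<open>y b\<close> for \<open>b \<in> E\<^sub>2\<close> by a functional that annihilates \<open>X\<^sub>2\<close>, and this does not
  change the value, because \<open>T\<close> maps \<open>E\<^sub>2\<close> into the biannihilator.
\<close>

section \<open>Scalars\<close>

text \<open>
  The element \<open>i\<close> is the imaginary unit for complex scalars and \<open>0\<close> for real ones. With this
  convention the decomposition of a scalar, and later the recovery of a functional from its real
  part, reads the same in both cases.
\<close>

lemma scalar_real_part: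
  obtains i :: "'k::real_or_complex" and \<rho> :: "'k \<Rightarrow> real"
  where "i = 0 \<or> i * i = - 1"
    and "\<And>z w. \<rho> (z + w) = \<rho> z + \<rho> w"
    and "\<And>r z. \<rho> (of_real r * z) = r * \<rho> z"
    and "\<And>z. \<bar>\<rho> z\<bar> \<le> norm z"
    and "\<rho> 1 = 1" and "\<rho> i = 0"
    and "\<And>z. z = of_real (\<rho> z) - of_real (\<rho> (i * z)) * i"
proof -
  consider (real) "\<forall>z::'k. \<exists>a. z = a *\<^sub>R 1"
    | (complex) i :: 'k where "i * i = - 1"
        "\<forall>z. \<exists>a b. z = a *\<^sub>R 1 + b *\<^sub>R i \<and> norm z = sqrt (a\<^sup>2 + b\<^sup>2)"
    using real_or_complex by blast
  then show thesis
  proof cases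
    case real
    then obtain \<rho> :: "'k \<Rightarrow> real" where \<rho>: "\<And>z. z = of_real (\<rho> z)"
      unfolding of_real_def by metis
    show thesis
    proof (rule that[of 0 \<rho>])
      show "\<rho> (z + w) = \<rho> z + \<rho> w" for z w
        by (metis \<rho> of_real_add of_real_eq_iff)
      show "\<rho> (of_real r * z) = r * \<rho> z" for r z
        by (metis \<rho> of_real_mult of_real_eq_iff)
      show "\<bar>\<rho> z\<bar> \<le> norm z" for z
        by (metis \<rho> norm_of_real order_refl)
      show "z = of_real (\<rho> z) - of_real (\<rho> (0 * z)) * 0" for z
        using \<rho> by simp
      show "\<rho> 1 = 1" "\<rho> 0 = 0"
        using \<rho>[of 1] \<rho>[of 0] by simp_all
    qed simp
  next
    case complex
    obtain \<rho> \<sigma> :: "'k \<Rightarrow> real"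
      where \<rho>\<sigma>: "\<And>z. z = of_real (\<rho> z) + of_real (\<sigma> z) * i"
        and nrm: "\<And>z. norm z = sqrt ((\<rho> z)\<^sup>2 + (\<sigma> z)\<^sup>2)"
      using complex(2) unfolding scaleR_conv_of_real mult_1_right by metis
    \<comment> \<open>Real and imaginary part are unique: otherwise \<open>i\<close> would be real, but its square is negative.\<close>
    have zero: "a = 0 \<and> b = 0" if "of_real a + of_real b * i = 0" for a b
    proof -
      have "of_real a = - (of_real b * i)"
        using that by (simp add: eq_neg_iff_add_eq_0)
      then have "of_real a * of_real a = of_real b * of_real b * (i * i)"
        by (simp add: algebra_simps)
      then have "of_real (a * a) = (of_real (- (b * b)) :: 'k)"
        using complex(1) by simp
      then have "a * a + b * b = 0"
        unfolding of_real_eq_iff by simp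
      then show ?thesis
        by (simp add: sum_squares_eq_zero_iff)
    qed
    have unique: "a = \<rho> z \<and> b = \<sigma> z" if "z = of_real a + of_real b * i" for a b z
    proof -
      have "of_real a + of_real b * i = of_real (\<rho> z) + of_real (\<sigma> z) * i"
        using that \<rho>\<sigma>[of z] by simp
      then have "of_real (a - \<rho> z) + of_real (b - \<sigma> z) * i = 0"
        by (simp add: algebra_simps)
      from zero[OF this] show ?thesis
        by simp
    qed
    show thesis
    proof (rule that[of i \<rho>])
      show "i = 0 \<or> i * i = - 1"
        using complex(1) by simp
      show "\<rho> (z + w) = \<rho> z + \<rho> w" for z w
      proof -
        have "z + w = of_real (\<rho> z + \<rho> w) + of_real (\<sigma> z + \<sigma> w) * i"
          using \<rho>\<sigma>[of z] \<rho>\<sigma>[of w] by (simp add: algebra_simps)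
        from unique[OF this] show ?thesis
          by simp
      qed
      show "\<rho> (of_real r * z) = r * \<rho> z" for r z
      proof -
        have "of_real r * z = of_real r * (of_real (\<rho> z) + of_real (\<sigma> z) * i)"
          using \<rho>\<sigma>[of z] by simp
        then have "of_real r * z = of_real (r * \<rho> z) + of_real (r * \<sigma> z) * i"
          by (simp add: algebra_simps)
        from unique[OF this] show ?thesis
          by simp
      qed
      show "\<rho> 1 = 1" "\<rho> i = 0"
        using unique[where a = 1 and b = 0] unique[where a = 0 and b = 1] by fastforce+
      show "\<bar>\<rho> z\<bar> \<le> norm z" for z
        unfolding nrm by (rule real_le_rsqrt) simp
      show "z = of_real (\<rho> z) - of_real (\<rho> (i * z)) * i" for z
      proof -
        have "i * z = i * (of_real (\<rho> z) + of_real (\<sigma> z) * i)"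
          using \<rho>\<sigma>[of z] by simp
        also have "\<dots> = of_real (\<rho> z) * i + of_real (\<sigma> z) * (i * i)"
          by (simp add: algebra_simps)
        finally have "i * z = of_real (- \<sigma> z) + of_real (\<rho> z) * i"
          using complex(1) by simp
        from unique[OF this] show ?thesis
          using \<rho>\<sigma>[of z] by (metis diff_minus_eq_add mult_minus_left of_real_minus)
      qed
    qed
  qed
qed

lemma scalar_ball_finite_net:
  fixes R d :: real
  assumes "d > 0"
  obtains A :: "'k::real_or_complex set"
  where "finite A" and "\<And>z. norm z \<le> R \<Longrightarrow> \<exists>a\<in>A. norm (z - a) \<le> d"
proof -
  obtain i :: 'k and \<rho> :: "'k \<Rightarrow> real"
    where \<rho>: "\<And>z. \<bar>\<rho> z\<bar> \<le> norm z" "\<And>z. z = of_real (\<rho> z) - of_real (\<rho> (i * z)) * i"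
    by (rule scalar_real_part) blast
  define d' where "d' = d / (1 + norm i)"
  have i_pos: "1 + norm i > 0"
    by (simp add: add_pos_nonneg)
  have "d' > 0"
    using assms i_pos by (simp add: d'_def)
  have "\<exists>A. finite A \<and> (\<forall>x. \<bar>x\<bar> \<le> M \<longrightarrow> (\<exists>a\<in>A. \<bar>x - a\<bar> < d'))" for M :: real
  proof -
    obtain A where "finite A" "{-M..M} \<subseteq> (\<Union>a\<in>A. ball a d')"
      using compact_Icc[of "-M" M] \<open>d' > 0\<close> unfolding compact_eq_totally_bounded by meson
    moreover from this have "\<exists>a\<in>A. \<bar>x - a\<bar> < d'" if "\<bar>x\<bar> \<le> M" for x
    proof -
      have "x \<in> {-M..M}"
        using that by auto
      then show ?thesis
        using \<open>{-M..M} \<subseteq> _\<close> by (force simp: dist_real_def abs_minus_commute)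
    qed
    ultimately show ?thesis
      by blast
  qed
  then obtain B where B: "finite (B M)" "\<And>x. \<bar>x\<bar> \<le> M \<Longrightarrow> \<exists>a\<in>B M. \<bar>x - a\<bar> < d'"
    for M :: real
    by metis
  define A where
    "A = (\<lambda>(a, b). of_real a - of_real b * i) ` (B R \<times> B (norm i * R))"
  show thesis
  proof (rule that[of A])
    show "finite A"
      using B(1) by (simp add: A_def)
    fix z :: 'k
    assume z: "norm z \<le> R"
    have "\<bar>\<rho> z\<bar> \<le> R" "\<bar>\<rho> (i * z)\<bar> \<le> norm i * R"
      using \<rho>(1)[of z] \<rho>(1)[of "i * z"] z mult_left_mono[OF z norm_ge_zero[of i]]
      by (simp_all add: norm_mult)
    then obtain a b where ab: "a \<in> B R" "\<bar>\<rho> z - a\<bar> < d'"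
      "b \<in> B (norm i * R)" "\<bar>\<rho> (i * z) - b\<bar> < d'"
      using B(2) by meson
    have "z - (of_real a - of_real b * i)
        = of_real (\<rho> z - a) - of_real (\<rho> (i * z) - b) * i"
      using \<rho>(2)[of z] by (simp add: algebra_simps)
    also have "norm \<dots> \<le> \<bar>\<rho> z - a\<bar> + \<bar>\<rho> (i * z) - b\<bar> * norm i"
      by (metis norm_triangle_ineq4 norm_mult norm_of_real)
    also have "\<dots> \<le> d' + d' * norm i"
      using ab by (intro add_mono mult_right_mono) auto
    also have "\<dots> = d"
      using i_pos unfolding d'_def by (metis distrib_left less_irrefl mult_1_right nonzero_eq_divide_eq)
    finally show "\<exists>a\<in>A. norm (z - a) \<le> d"
      using ab by (auto simp: A_def)
  qed
qed

lemma unimodular_multiple: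
  fixes z :: "'k::real_or_complex"
  obtains c :: 'k where "norm c = 1" "c * z = of_real (norm z)"
proof (cases "z = 0")
  case True
  then show thesis
    using that[of 1] by simp
next
  case False
  then show thesis
    using that[of "of_real (norm z) / z"] by (simp add: norm_divide)
qed

section \<open>The Hahn--Banach theorem\<close>

text \<open>
  Zorn's lemma is applied to graphs, that is, to linear subspaces \<open>G\<close> of \<open>V \<times> \<real>\<close> lying below the
  graph of \<open>p\<close>. Such a \<open>G\<close> is automatically the graph of a function: if it contains \<open>(x, a)\<close> and
  \<open>(x, b)\<close>, then it contains \<open>(0, a - b)\<close> and \<open>(0, b - a)\<close>, and \<open>p 0 = 0\<close>.
\<close>

lemma hahn_banach_real:
  fixes s :: "real \<Rightarrow> 'v::ab_group_add \<Rightarrow> 'v" and p f :: "'v \<Rightarrow> real"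
  assumes "vector_space s" "module.subspace s V" "module.subspace s W" "W \<subseteq> V"
    and p_add: "\<And>x y. \<lbrakk>x \<in> V; y \<in> V\<rbrakk> \<Longrightarrow> p (x + y) \<le> p x + p y"
    and p_scale: "\<And>r x. \<lbrakk>x \<in> V; r \<ge> 0\<rbrakk> \<Longrightarrow> p (s r x) = r * p x"
    and f_add: "\<And>x y. \<lbrakk>x \<in> W; y \<in> W\<rbrakk> \<Longrightarrow> f (x + y) = f x + f y"
    and f_scale: "\<And>r x. x \<in> W \<Longrightarrow> f (s r x) = r * f x"
    and f_le: "\<And>x. x \<in> W \<Longrightarrow> f x \<le> p x"
  obtains g where "\<And>x y. \<lbrakk>x \<in> V; y \<in> V\<rbrakk> \<Longrightarrow> g (x + y) = g x + g y"
    and "\<And>r x. x \<in> V \<Longrightarrow> g (s r x) = r * g x"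
    and "\<And>x. x \<in> V \<Longrightarrow> g x \<le> p x"
    and "\<And>x. x \<in> W \<Longrightarrow> g x = f x"
proof -
  interpret vector_space s by fact
  note V = \<open>subspace V\<close> and W = \<open>subspace W\<close>
  define dominated where "dominated G \<longleftrightarrow>
      (\<forall>x a y b. (x, a) \<in> G \<longrightarrow> (y, b) \<in> G \<longrightarrow> (x + y, a + b) \<in> G) \<and>
      (\<forall>r x a. (x, a) \<in> G \<longrightarrow> (s r x, r * a) \<in> G) \<and>
      (\<forall>x a. (x, a) \<in> G \<longrightarrow> x \<in> V \<and> a \<le> p x)" for G
  define G0 where "G0 = (\<lambda>x. (x, f x)) ` W"
  have G0: "dominated G0"
    using subspace_add[OF W] subspace_scale[OF W] f_add f_scale f_le \<open>W \<subseteq> V\<close>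
    unfolding dominated_def G0_def by (auto simp: image_iff)
  have "\<exists>M\<in>{G. dominated G \<and> G0 \<subseteq> G}. \<forall>G\<in>{G. dominated G \<and> G0 \<subseteq> G}. M \<subseteq> G \<longrightarrow> G = M"
  proof (rule subset_Zorn_nonempty)
    show "{G. dominated G \<and> G0 \<subseteq> G} \<noteq> {}"
      using G0 by blast
    fix C
    assume "C \<noteq> {}" and C: "subset.chain {G. dominated G \<and> G0 \<subseteq> G} C"
    have dom: "dominated G" "G0 \<subseteq> G" if "G \<in> C" for G
      using C that by (auto simp: subset.chain_def)
    have "(x + y, a + b) \<in> \<Union>C" if xy: "(x, a) \<in> \<Union>C" "(y, b) \<in> \<Union>C" for x a y b
    proof -
      obtain G H where "G \<in> C" "(x, a) \<in> G" "H \<in> C" "(y, b) \<in> H"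
        using xy by blast
      moreover have "G \<subseteq> H \<or> H \<subseteq> G"
        using C \<open>G \<in> C\<close> \<open>H \<in> C\<close> by (auto simp: subset_chain_def)
      ultimately obtain K where "K \<in> C" "(x, a) \<in> K" "(y, b) \<in> K"
        by blast
      then show ?thesis
        using dom(1) unfolding dominated_def by blast
    qed
    moreover have "(s r x, r * a) \<in> \<Union>C" if "(x, a) \<in> \<Union>C" for r x a
      using that dom(1) unfolding dominated_def by blast
    moreover have "x \<in> V \<and> a \<le> p x" if "(x, a) \<in> \<Union>C" for x a
      using that dom(1) unfolding dominated_def by blast
    moreover have "G0 \<subseteq> \<Union>C"
      using \<open>C \<noteq> {}\<close> dom(2) by blast
    ultimately show "\<Union>C \<in> {G. dominated G \<and> G0 \<subseteq> G}"
      unfolding dominated_def by blast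
  qed
  then obtain M where M: "dominated M" "G0 \<subseteq> M"
    and M_max: "\<forall>G\<in>{G. dominated G \<and> G0 \<subseteq> G}. M \<subseteq> G \<longrightarrow> G = M"
    by (elim bexE CollectE conjE) (rule that)
  have maximal: "G = M" if "dominated G" "M \<subseteq> G" for G
    using M_max M(2) that by (simp add: order_trans[OF M(2) that(2)])
  have M_add: "(x + y, a + b) \<in> M" if "(x, a) \<in> M" "(y, b) \<in> M" for x a y b
    using M(1) that unfolding dominated_def by blast
  have M_scale: "(s r x, r * a) \<in> M" if "(x, a) \<in> M" for r x a
    using M(1) that unfolding dominated_def by blast
  have M_le: "x \<in> V" "a \<le> p x" if "(x, a) \<in> M" for x a
    using M(1) that unfolding dominated_def by blast+
  have M_0: "(0, 0) \<in> M"
    using M(2) subspace_0[OF W] f_scale[of 0 0] by (auto simp: G0_def image_iff)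
  have M_diff: "(x - y, a - b) \<in> M" if "(x, a) \<in> M" "(y, b) \<in> M" for x a y b
    using M_add[OF that(1) M_scale[OF that(2), of "-1"]] by simp
  have p_0: "p 0 = 0"
    using p_scale[OF subspace_0[OF V], of 0] by simp
  have M_unique: "a = b" if "(x, a) \<in> M" "(x, b) \<in> M" for x a b
    using M_le(2)[OF M_diff[OF that]] M_le(2)[OF M_diff[OF that(2,1)]] p_0 by simp
  have M_total: "\<exists>a. (x, a) \<in> M" if "x \<in> V" for x
  proof (rule ccontr)
    assume not: "\<nexists>a. (x, a) \<in> M"
    have sandwich: "a - p (y - x) \<le> p (z + x) - b" if "(y, a) \<in> M" "(z, b) \<in> M" for y a z b
    proof -
      have "a + b \<le> p (y + z)"
        using M_le(2)[OF M_add[OF that]] .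
      also have "y + z = (y - x) + (z + x)"
        by simp
      also have "p \<dots> \<le> p (y - x) + p (z + x)"
        using M_le(1)[OF that(1)] M_le(1)[OF that(2)] \<open>x \<in> V\<close> V
        by (intro p_add subspace_diff subspace_add)
      finally show ?thesis
        by simp
    qed
    \<comment> \<open>By \<open>sandwich\<close>, the value \<open>c\<close> at \<open>x\<close> keeps the extended graph below \<open>p\<close>
       for both signs of the coefficient of \<open>x\<close>.\<close>
    define c where "c = (SUP (y, a)\<in>M. a - p (y - x))"
    have bdd: "bdd_above ((\<lambda>(y, a). a - p (y - x)) ` M)"
      using sandwich[OF _ M_0] by (intro bdd_aboveI[where M = "p (0 + x) - 0"]) auto
    have c_ge: "a - p (y - x) \<le> c" if "(y, a) \<in> M" for y a
      unfolding c_def using cSUP_upper[OF that bdd] by simp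
    have c_le: "c \<le> p (z + x) - b" if "(z, b) \<in> M" for z b
      unfolding c_def using M_0 sandwich[OF _ that] by (intro cSUP_least) auto
    have bound: "a + r * c \<le> p (y + s r x)" if ya: "(y, a) \<in> M" for r y a
    proof -
      consider "r = 0" | "r > 0" | "r < 0"
        by linarith
      then show ?thesis
      proof cases
        case 1
        then show ?thesis
          using M_le[OF ya] by simp
      next
        case 2
        have "y + s r x = s r (s (1 / r) y + x)"
          using 2 by (simp add: scale_right_distrib)
        moreover have "s (1 / r) y + x \<in> V"
          using M_le(1)[OF ya] \<open>x \<in> V\<close> V by (intro subspace_add subspace_scale)
        ultimately have "p (y + s r x) = r * p (s (1 / r) y + x)"
          using p_scale 2 by simp
        moreover have "r * c \<le> r * (p (s (1 / r) y + x) - (1 / r) * a)"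
          using c_le[OF M_scale[OF ya, of "1 / r"]] 2 by (intro mult_left_mono) auto
        ultimately show ?thesis
          using 2 by (simp add: algebra_simps)
      next
        case 3
        have "y + s r x = s (- r) (s (- 1 / r) y - x)"
          using 3 by (simp add: scale_right_diff_distrib)
        moreover have "s (- 1 / r) y - x \<in> V"
          using M_le(1)[OF ya] \<open>x \<in> V\<close> V by (intro subspace_diff subspace_scale)
        ultimately have "p (y + s r x) = (- r) * p (s (- 1 / r) y - x)"
          using p_scale[of "s (- 1 / r) y - x" "- r"] 3 by simp
        moreover have "(- r) * ((- 1 / r) * a - p (s (- 1 / r) y - x)) \<le> (- r) * c"
          using c_ge[OF M_scale[OF ya, of "- 1 / r"]] 3 by (intro mult_left_mono) auto
        ultimately show ?thesis
          using 3 by (simp add: algebra_simps)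
      qed
    qed
    define G where "G = {(y + s r x, a + r * c) | y a r. (y, a) \<in> M}"
    have GI: "(y + s r x, a + r * c) \<in> G" if "(y, a) \<in> M" for y a r
      using that by (auto simp: G_def)
    have "dominated G"
      unfolding dominated_def
    proof (intro conjI allI impI)
      fix y a z b
      assume "(y, a) \<in> G" "(z, b) \<in> G"
      then obtain y' a' r z' b' t where eq: "y = y' + s r x" "a = a' + r * c" "(y', a') \<in> M"
        "z = z' + s t x" "b = b' + t * c" "(z', b') \<in> M"
        by (auto simp: G_def)
      have "y + z = (y' + z') + s (r + t) x" "a + b = (a' + b') + (r + t) * c"
        using eq by (simp_all add: scale_left_distrib algebra_simps)
      then show "(y + z, a + b) \<in> G"
        using GI[OF M_add[OF eq(3,6)]] by metis
    next
      fix r y a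
      assume "(y, a) \<in> G"
      then obtain y' a' t where eq: "y = y' + s t x" "a = a' + t * c" "(y', a') \<in> M"
        by (auto simp: G_def)
      have "s r y = s r y' + s (r * t) x" "r * a = r * a' + (r * t) * c"
        using eq by (simp_all add: scale_right_distrib algebra_simps)
      then show "(s r y, r * a) \<in> G"
        using GI[OF M_scale[OF eq(3)]] by metis
    next
      fix y a
      assume "(y, a) \<in> G"
      then obtain y' a' t where eq: "y = y' + s t x" "a = a' + t * c" "(y', a') \<in> M"
        by (auto simp: G_def)
      show "y \<in> V" "a \<le> p y"
        using eq bound[OF eq(3)] M_le(1)[OF eq(3)] \<open>x \<in> V\<close> V
        by (auto intro!: subspace_add subspace_scale)
    qed
    moreover have "M \<subseteq> G"
      using GI[of _ _ 0] by auto
    ultimately have "G = M"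
      by (rule maximal)
    moreover have "(x, c) \<in> G"
      using GI[OF M_0, of 1] by simp
    ultimately show False
      using not by blast
  qed
  define g where "g x = (THE a. (x, a) \<in> M)" for x
  have g_eq: "g x = a" if "(x, a) \<in> M" for x a
    unfolding g_def using that M_unique by blast
  have g_mem: "(x, g x) \<in> M" if "x \<in> V" for x
    using M_total[OF that] g_eq by blast
  show thesis
  proof (rule that[of g])
    show "g (x + y) = g x + g y" if "x \<in> V" "y \<in> V" for x y
      using that by (intro g_eq M_add g_mem)
    show "g (s r x) = r * g x" if "x \<in> V" for r x
      using that by (intro g_eq M_scale g_mem)
    show "g x \<le> p x" if "x \<in> V" for x
      using that by (intro M_le(2) g_mem)
    show "g x = f x" if "x \<in> W" for x
      using that M(2) by (intro g_eq) (auto simp: G0_def)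
  qed
qed

text \<open>If \<open>c \<noteq> 0\<close>, the assumption for \<open>1 / c\<close> and \<open>s c x\<close> is the reverse inequality.\<close>

lemma homogeneous_if_le:
  fixes s :: "'k::real_or_complex \<Rightarrow> 'v::ab_group_add \<Rightarrow> 'v" and p :: "'v \<Rightarrow> real"
  assumes "vector_space s"
    and V: "\<And>c x. x \<in> V \<Longrightarrow> s c x \<in> V"
    and le: "\<And>c x. x \<in> V \<Longrightarrow> p (s c x) \<le> norm c * p x"
    and nonneg: "\<And>x. x \<in> V \<Longrightarrow> 0 \<le> p x"
    and x: "x \<in> V"
  shows "p (s c x) = norm c * p x"
proof (cases "c = 0")
  case True
  then show ?thesis
    using le[OF x, of c] nonneg[OF V[OF x, of c]] by simp
next
  case False
  interpret vector_space s by fact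
  have "p x \<le> norm (1 / c) * p (s c x)"
    using le[OF V[OF x, of c], of "1 / c"] False by simp
  then show ?thesis
    using False le[OF x, of c] by (simp add: norm_divide field_simps)
qed

text \<open>
  The real part of \<open>f\<close> is extended to a real functional \<open>u\<close>, and \<open>u x - i u(i x)\<close> defines the only
  scalar-linear functional with real part \<open>u\<close>. Its modulus at \<open>x\<close> is its value at a unimodular
  multiple of \<open>x\<close>, where it equals \<open>u\<close>.
\<close>

lemma hahn_banach:
  fixes s :: "'k::real_or_complex \<Rightarrow> 'v::ab_group_add \<Rightarrow> 'v" and p :: "'v \<Rightarrow> real"
    and f :: "'v \<Rightarrow> 'k"
  assumes "vector_space s" "module.subspace s V" "module.subspace s W" "W \<subseteq> V"
    and p_add: "\<And>x y. \<lbrakk>x \<in> V; y \<in> V\<rbrakk> \<Longrightarrow> p (x + y) \<le> p x + p y"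
    and p_scale: "\<And>c x. x \<in> V \<Longrightarrow> p (s c x) = norm c * p x"
    and f_add: "\<And>x y. \<lbrakk>x \<in> W; y \<in> W\<rbrakk> \<Longrightarrow> f (x + y) = f x + f y"
    and f_scale: "\<And>c x. x \<in> W \<Longrightarrow> f (s c x) = c * f x"
    and f_le: "\<And>x. x \<in> W \<Longrightarrow> norm (f x) \<le> p x"
  obtains g where "\<And>x y. \<lbrakk>x \<in> V; y \<in> V\<rbrakk> \<Longrightarrow> g (x + y) = g x + g y"
    and "\<And>c x. x \<in> V \<Longrightarrow> g (s c x) = c * g x"
    and "\<And>x. x \<in> V \<Longrightarrow> norm (g x) \<le> p x"
    and "\<And>x. x \<in> W \<Longrightarrow> g x = f x"
proof -
  interpret vector_space s by fact
  note V = \<open>subspace V\<close> and W = \<open>subspace W\<close>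
  obtain i :: 'k and \<rho> :: "'k \<Rightarrow> real"
    where i: "i = 0 \<or> i * i = - 1"
      and \<rho>_add: "\<And>z w. \<rho> (z + w) = \<rho> z + \<rho> w"
      and \<rho>_scale: "\<And>r z. \<rho> (of_real r * z) = r * \<rho> z"
      and \<rho>_le: "\<And>z. \<bar>\<rho> z\<bar> \<le> norm z"
      and \<rho>_units: "\<rho> 1 = 1" "\<rho> i = 0"
      and \<rho>_repr: "\<And>z. z = of_real (\<rho> z) - of_real (\<rho> (i * z)) * i"
    by (rule scalar_real_part) blast
  define sr where "sr = (\<lambda>r. s (of_real r))"
  have "vector_space sr"
    by unfold_locales (simp_all add: sr_def scale_right_distrib scale_left_distrib)
  then interpret real: vector_space sr .
  have real_subspace: "real.subspace U" if "subspace U" for U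
    using that unfolding real.subspace_def subspace_def by (simp add: sr_def)
  obtain u where u_add: "\<And>x y. \<lbrakk>x \<in> V; y \<in> V\<rbrakk> \<Longrightarrow> u (x + y) = u x + u y"
    and u_scale: "\<And>r x. x \<in> V \<Longrightarrow> u (sr r x) = r * u x"
    and u_le: "\<And>x. x \<in> V \<Longrightarrow> u x \<le> p x"
    and u_f: "\<And>x. x \<in> W \<Longrightarrow> u x = \<rho> (f x)"
  proof (rule hahn_banach_real[of sr V W p "\<lambda>x. \<rho> (f x)"])
    show "\<rho> (f x) \<le> p x" if "x \<in> W" for x
      using \<rho>_le[of "f x"] f_le[OF that] by linarith
  qed (use \<open>vector_space sr\<close> V W real_subspace \<open>W \<subseteq> V\<close> p_add p_scale f_add f_scale \<rho>_add \<rho>_scale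
      in \<open>auto simp: sr_def\<close>)
  define g where "g x = of_real (u x) - of_real (u (s i x)) * i" for x
  have g_add: "g (x + y) = g x + g y" if "x \<in> V" "y \<in> V" for x y
    using that u_add subspace_scale[OF V] by (simp add: g_def scale_right_distrib algebra_simps)
  have g_real: "g (s (of_real r) x) = of_real r * g x" if "x \<in> V" for r x
  proof -
    have "s i (s (of_real r) x) = sr r (s i x)"
      by (simp add: sr_def mult.commute)
    then show ?thesis
      using that u_scale[of x r] u_scale[of "s i x" r] subspace_scale[OF V]
      by (simp add: g_def sr_def algebra_simps)
  qed
  have g_i: "g (s i x) = i * g x" if "x \<in> V" for x
  proof (cases "i = 0")
    case True
    then show ?thesis
      using u_scale[OF subspace_0[OF V], of 0] by (simp add: g_def)
  next
    case False
    then have "i * i = - 1"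
      using i by blast
    moreover have "u (- x) = - u x"
      using u_scale[OF that, of "-1"] by (simp add: sr_def)
    moreover have "i * g x = of_real (u x) * i - of_real (u (s i x)) * (i * i)"
      by (simp add: g_def algebra_simps)
    ultimately show ?thesis
      by (simp add: g_def)
  qed
  have g_scale: "g (s c x) = c * g x" if "x \<in> V" for c x
  proof -
    define a b where "a = \<rho> c" and "b = - \<rho> (i * c)"
    have c: "c = of_real a + of_real b * i"
      using \<rho>_repr[of c] by (simp add: a_def b_def)
    have "g (s c x) = g (s (of_real a) x + s (of_real b) (s i x))"
      by (simp add: c scale_left_distrib)
    also have "\<dots> = of_real a * g x + of_real b * (i * g x)"
      using that subspace_scale[OF V] g_add g_real g_i by (simp del: scale_scale)
    also have "\<dots> = c * g x"
      by (simp add: c algebra_simps)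
    finally show ?thesis .
  qed
  show thesis
  proof (rule that[of g, OF g_add g_scale])
    show "norm (g x) \<le> p x" if x: "x \<in> V" for x
    proof -
      obtain c where norm_c: "norm c = 1" and "c * g x = of_real (norm (g x))"
        by (rule unimodular_multiple)
      then have "g (s c x) = of_real (norm (g x))"
        using g_scale[OF x] by simp
      moreover have "\<rho> (g y) = u y" for y
        using \<rho>_add[of "of_real (u y) * 1" "of_real (- u (s i y)) * i"]
        unfolding \<rho>_scale by (simp add: g_def \<rho>_units)
      moreover have "\<rho> (of_real r) = r" for r
        using \<rho>_scale[of r 1] by (simp add: \<rho>_units)
      ultimately have "norm (g x) = u (s c x)"
        by metis
      also have "\<dots> \<le> p x"
        using u_le[OF subspace_scale[OF V x, of c]] p_scale[OF x, of c] norm_c by simp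
      finally show ?thesis .
    qed
    show "g x = f x" if "x \<in> W" for x
    proof -
      have "s i x \<in> W"
        using subspace_scale[OF W that] .
      then show ?thesis
        using \<rho>_repr[of "f x"] that by (simp add: g_def u_f f_scale)
    qed
  qed
qed

section \<open>Normed spaces and bounded operators\<close>

lemma sum_apply: "(\<Sum>a\<in>A. F a) x = (\<Sum>a\<in>A. F a x)"
  by (induction A rule: infinite_finite_induct) auto

context normed_space
begin

lemma car_0: "0 \<in> car N"
  using subspace_0[OF subspace_car] .

lemma car_add: "\<lbrakk>x \<in> car N; y \<in> car N\<rbrakk> \<Longrightarrow> x + y \<in> car N"
  using subspace_add[OF subspace_car] .

lemma car_smul: "x \<in> car N \<Longrightarrow> smul N c x \<in> car N"
  using subspace_scale[OF subspace_car] .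

lemma car_diff: "\<lbrakk>x \<in> car N; y \<in> car N\<rbrakk> \<Longrightarrow> x - y \<in> car N"
  using subspace_diff[OF subspace_car] .

lemma car_sum: "(\<And>a. a \<in> A \<Longrightarrow> f a \<in> car N) \<Longrightarrow> (\<Sum>a\<in>A. f a) \<in> car N"
  using subspace_sum[OF subspace_car] .

lemma nrm_0: "nrm N 0 = 0"
  using nrm_eq_0_iff[OF car_0] by simp

lemma nrm_ge_0: "x \<in> car N \<Longrightarrow> 0 \<le> nrm N x"
  using nrm_triangle[of x "smul N (- 1) x"] nrm_smul[of x "- 1"] car_smul[of x "- 1"] nrm_0
  by simp

lemma nrm_sum_le:
  "(\<And>a. a \<in> A \<Longrightarrow> f a \<in> car N) \<Longrightarrow> nrm N (\<Sum>a\<in>A. f a) \<le> (\<Sum>a\<in>A. nrm N (f a))"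
proof (induction A rule: infinite_finite_induct)
  case (insert a A)
  then show ?case
    using nrm_triangle[of "f a" "sum f A"] car_sum[of A f] by (simp add: order_trans)
qed (simp_all add: nrm_0)

lemma normalized:
  assumes "x \<in> car N" "x \<noteq> 0"
  obtains u where "u \<in> car N" "nrm N u = 1" "x = smul N (of_real (nrm N x)) u"
proof (rule that[of "smul N (of_real (1 / nrm N x)) x"])
  have "nrm N x > 0"
    using assms nrm_ge_0 nrm_eq_0_iff by (metis less_eq_real_def)
  then show "nrm N (smul N (of_real (1 / nrm N x)) x) = 1"
    and "x = smul N (of_real (nrm N x)) (smul N (of_real (1 / nrm N x)) x)"
    using nrm_smul[OF assms(1)] by (simp_all add: norm_divide)
qed (use assms car_smul in blast)

lemma normed_subspace: "subspace U \<Longrightarrow> U \<subseteq> car N \<Longrightarrow> normed_space (N\<lparr>car := U\<rparr>)"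
  using nrm_eq_0_iff nrm_smul nrm_triangle vector_space_axioms
  by (simp add: normed_space_def normed_space_axioms_def subset_iff)

end

locale operators = dom: normed_space N + cod: normed_space M
  for N :: "('k::real_or_complex, 'a::ab_group_add) nspace"
    and M :: "('k, 'b::ab_group_add) nspace"
begin

lemma bounded_operatorsI:
  assumes "\<And>x. x \<in> car N \<Longrightarrow> T x \<in> car M"
    and "\<And>x y. \<lbrakk>x \<in> car N; y \<in> car N\<rbrakk> \<Longrightarrow> T (x + y) = T x + T y"
    and "\<And>c x. x \<in> car N \<Longrightarrow> T (smul N c x) = smul M c (T x)"
    and "\<And>x. x \<in> car N \<Longrightarrow> nrm M (T x) \<le> K * nrm N x"
    and "\<And>x. x \<notin> car N \<Longrightarrow> T x = 0"
  shows "T \<in> bounded_operators N M"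
  unfolding bounded_operators_def using assms(1-3,5) exI[of _ K] assms(4) by blast

lemma op_nrm_def: "nrm (operator_space N M) T = (SUP x\<in>{x \<in> car N. nrm N x \<le> 1}. nrm M (T x))"
  by (simp add: operator_space_def)

lemma op_nrm_least:
  assumes "\<And>x. \<lbrakk>x \<in> car N; nrm N x \<le> 1\<rbrakk> \<Longrightarrow> nrm M (T x) \<le> K"
  shows "nrm (operator_space N M) T \<le> K"
  unfolding op_nrm_def
proof (rule cSUP_least)
  show "{x \<in> car N. nrm N x \<le> 1} \<noteq> {}"
    using dom.car_0 dom.nrm_0 by force
qed (use assms in blast)

lemma op_nrm_le:
  assumes "\<And>x. x \<in> car N \<Longrightarrow> nrm M (T x) \<le> K * nrm N x" "0 \<le> K"
  shows "nrm (operator_space N M) T \<le> K"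
proof (rule op_nrm_least)
  show "nrm M (T x) \<le> K" if "x \<in> car N" "nrm N x \<le> 1" for x
    using assms(1)[OF that(1)] mult_left_mono[OF that(2) assms(2)] by simp
qed

context
  fixes T
  assumes T: "T \<in> bounded_operators N M"
begin

lemma op_car: "x \<in> car N \<Longrightarrow> T x \<in> car M"
  and op_add: "\<lbrakk>x \<in> car N; y \<in> car N\<rbrakk> \<Longrightarrow> T (x + y) = T x + T y"
  and op_smul: "x \<in> car N \<Longrightarrow> T (smul N c x) = smul M c (T x)"
  and op_outside: "x \<notin> car N \<Longrightarrow> T x = 0"
  using T by (simp_all add: bounded_operators_def)

lemma op_0: "T 0 = 0"
  using op_add[OF dom.car_0 dom.car_0] by simp

lemma op_diff: "\<lbrakk>x \<in> car N; y \<in> car N\<rbrakk> \<Longrightarrow> T (x - y) = T x - T y"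
  using op_add[of "x - y" y] dom.car_diff[of x y] by simp

lemma op_sum: "(\<And>a. a \<in> A \<Longrightarrow> f a \<in> car N) \<Longrightarrow> T (\<Sum>a\<in>A. f a) = (\<Sum>a\<in>A. T (f a))"
proof (induction A rule: infinite_finite_induct)
  case (insert a A)
  then show ?case
    using op_add[of "f a" "sum f A"] dom.car_sum[of A f] by simp
qed (simp_all add: op_0)

lemma op_bdd: "bdd_above ((\<lambda>x. nrm M (T x)) ` {x \<in> car N. nrm N x \<le> 1})"
proof -
  obtain K where K: "\<And>x. x \<in> car N \<Longrightarrow> nrm M (T x) \<le> K * nrm N x"
    using T unfolding bounded_operators_def by blast
  have "nrm M (T x) \<le> \<bar>K\<bar>" if "x \<in> car N" "nrm N x \<le> 1" for x
  proof -
    have "K * nrm N x \<le> \<bar>K\<bar> * 1"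
      using that dom.nrm_ge_0[of x] by (intro mult_mono) auto
    then show ?thesis
      using K[OF that(1)] by simp
  qed
  then show ?thesis
    by (auto intro!: bdd_aboveI)
qed

lemma op_nrm_upper: "\<lbrakk>x \<in> car N; nrm N x \<le> 1\<rbrakk> \<Longrightarrow> nrm M (T x) \<le> nrm (operator_space N M) T"
  unfolding op_nrm_def using op_bdd by (intro cSUP_upper) auto

lemma op_nrm_ge_0: "0 \<le> nrm (operator_space N M) T"
  using op_nrm_upper[OF dom.car_0] dom.nrm_0 cod.nrm_0 op_0 by simp

lemma op_apply_le:
  assumes "x \<in> car N"
  shows "nrm M (T x) \<le> nrm (operator_space N M) T * nrm N x"
proof (cases "x = 0")
  case True
  then show ?thesis
    by (simp add: op_0 dom.nrm_0 cod.nrm_0)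
next
  case False
  then obtain u where u: "u \<in> car N" "nrm N u = 1" "x = smul N (of_real (nrm N x)) u"
    using dom.normalized assms by blast
  have "T x = smul M (of_real (nrm N x)) (T u)"
    using op_smul[OF u(1)] u(3) by metis
  then have "nrm M (T x) = nrm N x * nrm M (T u)"
    using cod.nrm_smul[OF op_car[OF u(1)]] dom.nrm_ge_0[OF assms] by simp
  also have "\<dots> \<le> nrm N x * nrm (operator_space N M) T"
    using u dom.nrm_ge_0[OF assms] by (intro mult_left_mono op_nrm_upper) auto
  finally show ?thesis
    by (simp add: mult.commute)
qed

lemma op_nrm_nearly_attained:
  assumes "\<delta> > 0"
  obtains x where "x \<in> car N" "nrm N x \<le> 1" "nrm (operator_space N M) T \<le> nrm M (T x) + \<delta>"
proof -
  have "{x \<in> car N. nrm N x \<le> 1} \<noteq> {}"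
    using dom.car_0 dom.nrm_0 by force
  moreover have "nrm (operator_space N M) T - \<delta> < nrm (operator_space N M) T"
    using assms by simp
  ultimately obtain x where "x \<in> car N" "nrm N x \<le> 1"
    "nrm (operator_space N M) T - \<delta> < nrm M (T x)"
    using less_cSUP_iff[OF _ op_bdd] unfolding op_nrm_def by blast
  then show thesis
    using that by force
qed

end

lemma normed_operator_space: "normed_space (operator_space N M)"
proof -
  have smul: "smul (operator_space N M) = (\<lambda>c T x. smul M c (T x))"
    and car: "car (operator_space N M) = bounded_operators N M"
    by (simp_all add: operator_space_def)
  have vs: "vector_space (smul (operator_space N M))"
    by unfold_locales
      (simp_all add: smul fun_eq_iff cod.scale_right_distrib cod.scale_left_distrib)
  have zero: "0 \<in> bounded_operators N M"
    by (intro bounded_operatorsI[where K = 0]) (simp_all add: cod.car_0 cod.nrm_0)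
  have add_le: "nrm M ((S + T) x) \<le>
      (nrm (operator_space N M) S + nrm (operator_space N M) T) * nrm N x"
    if "S \<in> bounded_operators N M" "T \<in> bounded_operators N M" "x \<in> car N" for S T x
    using cod.nrm_triangle[of "S x" "T x"] op_apply_le[of S x] op_apply_le[of T x] op_car that
    by (simp add: distrib_right)
  have add: "S + T \<in> bounded_operators N M"
    if "S \<in> bounded_operators N M" "T \<in> bounded_operators N M" for S T
    by (intro bounded_operatorsI[OF _ _ _ add_le])
      (use that in \<open>simp_all add: op_car op_add op_smul op_outside cod.car_add
          cod.scale_right_distrib algebra_simps\<close>)
  have smul_le: "nrm M (smul M c (T x)) \<le> (norm c * nrm (operator_space N M) T) * nrm N x"
    if "T \<in> bounded_operators N M" "x \<in> car N" for c T x
    using op_apply_le[OF that] cod.nrm_smul[OF op_car[OF that]]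
    by (simp add: mult.assoc mult_left_mono)
  have scale: "(\<lambda>x. smul M c (T x)) \<in> bounded_operators N M"
    if "T \<in> bounded_operators N M" for c T
    by (intro bounded_operatorsI[OF _ _ _ smul_le])
      (use that in \<open>simp_all add: op_car op_add op_smul op_outside cod.car_smul
          cod.scale_right_distrib mult.commute\<close>)
  have nrm_scale_le: "nrm (operator_space N M) (\<lambda>x. smul M c (T x))
      \<le> norm c * nrm (operator_space N M) T" if "T \<in> bounded_operators N M" for c T
    using that by (intro op_nrm_le[OF smul_le]) (simp_all add: op_nrm_ge_0)
  have nrm_scale: "nrm (operator_space N M) (\<lambda>x. smul M c (T x))
      = norm c * nrm (operator_space N M) T" if T: "T \<in> bounded_operators N M" for c T
    using homogeneous_if_le[OF vs, of "bounded_operators N M" "nrm (operator_space N M)", unfolded smul]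
      scale nrm_scale_le op_nrm_ge_0 T by blast
  show ?thesis
  proof (intro normed_space.intro normed_space_axioms.intro)
    show "vector_space (smul (operator_space N M))"
      by (fact vs)
    show "module.subspace (smul (operator_space N M)) (car (operator_space N M))"
      using zero add scale vs
      by (simp add: module.subspace_def module_iff_vector_space car) (simp add: smul)
    show "nrm (operator_space N M) T = 0 \<longleftrightarrow> T = 0" if "T \<in> car (operator_space N M)" for T
    proof
      assume "nrm (operator_space N M) T = 0"
      then have "nrm M (T x) = 0" if "x \<in> car N" for x
        using op_apply_le[of T x] cod.nrm_ge_0[of "T x"] op_car[of T x] that
          \<open>T \<in> car (operator_space N M)\<close> by (simp add: car)
      then have "T x = 0" for x
        using cod.nrm_eq_0_iff[of "T x"] op_car[of T x] op_outside[of T x]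
          \<open>T \<in> car (operator_space N M)\<close> by (cases "x \<in> car N") (simp_all add: car)
      then show "T = 0"
        by (simp add: fun_eq_iff)
    next
      assume "T = 0"
      then show "nrm (operator_space N M) T = 0"
        using op_nrm_le[of T 0] op_nrm_ge_0[OF zero] by (simp add: cod.nrm_0)
    qed
    show "nrm (operator_space N M) (smul (operator_space N M) c T)
        = norm c * nrm (operator_space N M) T" if "T \<in> car (operator_space N M)" for c T
      using that nrm_scale by (simp add: car smul)
    show "nrm (operator_space N M) (S + T)
        \<le> nrm (operator_space N M) S + nrm (operator_space N M) T"
      if "S \<in> car (operator_space N M)" "T \<in> car (operator_space N M)" for S T
      using that by (intro op_nrm_le add_le) (simp_all add: car op_nrm_ge_0)
  qed
qed

end

lemma pair_operator_space_sel:
  "car (pair_operator_space N V M W) = {S \<in> bounded_operators N M. S ` V \<subseteq> W}"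
  "smul (pair_operator_space N V M W) = smul (operator_space N M)"
  "nrm (pair_operator_space N V M W) = nrm (operator_space N M)"
  by (simp_all add: pair_operator_space_def operator_space_def)

lemma (in operators) normed_pair_operator_space:
  assumes "cod.subspace W"
  shows "normed_space (pair_operator_space N V M W)"
proof -
  interpret op: normed_space "operator_space N M"
    by (rule normed_operator_space)
  have "op.subspace {S \<in> bounded_operators N M. S ` V \<subseteq> W}"
    using op.subspace_car cod.subspace_0[OF assms] cod.subspace_add[OF assms]
      cod.subspace_scale[OF assms]
    unfolding op.subspace_def image_subset_iff by (simp add: operator_space_def)
  then show ?thesis
    unfolding pair_operator_space_def
    by (intro op.normed_subspace) (auto simp: operator_space_def)
qed

section \<open>Functionals\<close>

lemma scalar_space_sel [simp]:
  "car scalar_space = UNIV" "smul scalar_space = (*)" "nrm scalar_space = norm"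
  by (simp_all add: scalar_space_def)

lemma normed_scalar_space: "normed_space (scalar_space :: ('k::real_or_complex, 'k) nspace)"
proof -
  have vs: "vector_space ((*) :: 'k \<Rightarrow> 'k \<Rightarrow> 'k)"
    by unfold_locales (simp_all add: algebra_simps)
  then interpret vector_space "(*) :: 'k \<Rightarrow> 'k \<Rightarrow> 'k" .
  show ?thesis
    using vs subspace_UNIV
    by (simp add: normed_space_def normed_space_axioms_def norm_mult norm_triangle_ineq)
qed

lemma dual_sel:
  "car (dual N) = bounded_operators N scalar_space"
  "smul (dual N) = (\<lambda>c f x. c * f x)"
  "nrm (dual N) = nrm (operator_space N scalar_space)"
  by (simp_all add: dual_def operator_space_def)

context normed_space
begin

lemma functionals: "operators N (scalar_space :: ('k, 'k) nspace)"
  by (intro operators.intro normed_scalar_space normed_space_axioms)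

lemma normed_dual: "normed_space (dual N)"
  unfolding dual_def using operators.normed_operator_space[OF functionals] .

lemma dualI:
  assumes "\<And>x y. \<lbrakk>x \<in> car N; y \<in> car N\<rbrakk> \<Longrightarrow> f (x + y) = f x + f y"
    and "\<And>c x. x \<in> car N \<Longrightarrow> f (smul N c x) = c * f x"
    and "\<And>x. x \<in> car N \<Longrightarrow> norm (f x) \<le> K * nrm N x"
    and "\<And>x. x \<notin> car N \<Longrightarrow> f x = 0"
  shows "f \<in> car (dual N)"
  unfolding dual_sel using assms
  by (intro operators.bounded_operatorsI[OF functionals, where K = K]) simp_all

lemma dual_nrm_le:
  assumes "\<And>x. x \<in> car N \<Longrightarrow> norm (f x) \<le> K * nrm N x" "0 \<le> K"
  shows "nrm (dual N) f \<le> K"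
  unfolding dual_sel using assms by (intro operators.op_nrm_le[OF functionals]) simp_all

context
  fixes f
  assumes f: "f \<in> car (dual N)"
begin

lemmas in_functionals = f[unfolded dual_sel]

lemma dual_add: "\<lbrakk>x \<in> car N; y \<in> car N\<rbrakk> \<Longrightarrow> f (x + y) = f x + f y"
  using operators.op_add[OF functionals in_functionals] .

lemma dual_smul: "x \<in> car N \<Longrightarrow> f (smul N c x) = c * f x"
  using operators.op_smul[OF functionals in_functionals] by simp

lemma dual_outside: "x \<notin> car N \<Longrightarrow> f x = 0"
  using operators.op_outside[OF functionals in_functionals] .

lemma dual_0: "f 0 = 0"
  using operators.op_0[OF functionals in_functionals] .

lemma dual_diff: "\<lbrakk>x \<in> car N; y \<in> car N\<rbrakk> \<Longrightarrow> f (x - y) = f x - f y"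
  using operators.op_diff[OF functionals in_functionals] .

lemma dual_sum: "(\<And>a. a \<in> A \<Longrightarrow> g a \<in> car N) \<Longrightarrow> f (\<Sum>a\<in>A. g a) = (\<Sum>a\<in>A. f (g a))"
  using operators.op_sum[OF functionals in_functionals] .

lemma dual_apply_le: "x \<in> car N \<Longrightarrow> norm (f x) \<le> nrm (dual N) f * nrm N x"
  using operators.op_apply_le[OF functionals in_functionals] by (simp add: dual_sel)

lemma dual_nrm_nearly_attained:
  assumes "\<delta> > 0"
  obtains x where "x \<in> car N" "nrm N x \<le> 1" "nrm (dual N) f \<le> norm (f x) + \<delta>"
  using operators.op_nrm_nearly_attained[OF functionals in_functionals assms] that
  unfolding dual_sel scalar_space_sel by blast

end

text \<open>The functional \<open>c x \<mapsto> c\<close> on the line through \<open>x\<close> is extended to the whole space.\<close>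

lemma separating_functional:
  assumes x: "x \<in> car N" "x \<noteq> 0"
  obtains f where "f \<in> car (dual N)" "f x \<noteq> 0"
proof -
  have pos: "nrm N x > 0"
    using x nrm_ge_0 nrm_eq_0_iff by (metis less_eq_real_def)
  define h where "h y = (SOME c. y = smul N c x)" for y
  have h: "h (smul N c x) = c" for c
    unfolding h_def using x(2) by (intro some_equality) (simp_all add: scale_right_imp_eq)
  have W: "subspace (range (\<lambda>c. smul N c x))"
    unfolding subspace_def
    by (auto simp: scale_left_distrib[symmetric] image_iff)
  obtain g where g: "\<And>u v. \<lbrakk>u \<in> car N; v \<in> car N\<rbrakk> \<Longrightarrow> g (u + v) = g u + g v"
    "\<And>c u. u \<in> car N \<Longrightarrow> g (smul N c u) = c * g u"
    "\<And>u. u \<in> car N \<Longrightarrow> norm (g u) \<le> 1 / nrm N x * nrm N u"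
    "\<And>u. u \<in> range (\<lambda>c. smul N c x) \<Longrightarrow> g u = h u"
  proof (rule hahn_banach[OF vector_space_axioms subspace_car W,
        where p = "\<lambda>u. 1 / nrm N x * nrm N u" and f = h])
    show "range (\<lambda>c. smul N c x) \<subseteq> car N"
      using car_smul[OF x(1)] by blast
    show "1 / nrm N x * nrm N (u + v) \<le> 1 / nrm N x * nrm N u + 1 / nrm N x * nrm N v"
      if "u \<in> car N" "v \<in> car N" for u v
      using nrm_triangle[OF that] pos by (simp add: divide_simps)
    show "h (u + v) = h u + h v"
      if "u \<in> range (\<lambda>c. smul N c x)" "v \<in> range (\<lambda>c. smul N c x)" for u v
      using that h by (auto simp: scale_left_distrib[symmetric])
    show "h (smul N c u) = c * h u" if "u \<in> range (\<lambda>c. smul N c x)" for c u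
      using that h by auto
    show "norm (h u) \<le> 1 / nrm N x * nrm N u" if "u \<in> range (\<lambda>c. smul N c x)" for u
      using that h pos nrm_smul[OF x(1)] by auto
  qed (use nrm_smul in auto)
  define f where "f u = (if u \<in> car N then g u else 0)" for u
  have "f \<in> car (dual N)"
    using g(1-3) car_add car_smul by (intro dualI[where K = "1 / nrm N x"]) (simp_all add: f_def)
  moreover have "f x = 1"
    using g(4)[OF rangeI[of _ 1]] h[of 1] x(1) by (simp add: f_def)
  ultimately show thesis
    using that by simp
qed

text \<open>
  This is the continuity of coordinates on a finite-dimensional space, obtained without any
  compactness argument. To pass from \<open>B\<close> to \<open>insert c B\<close>, the part of \<open>c\<close> that \<open>f\<close> sees in the
  span of \<open>B\<close> is subtracted from \<open>c\<close>; some \<open>g\<close> does not vanish at the remainder \<open>c'\<close>. Subtracting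
  from \<open>g\<close> its part in the span of the \<open>f b\<close> makes it vanish on \<open>B\<close>, while its value at \<open>c\<close>
  becomes \<open>g c' \<noteq> 0\<close>.
\<close>

lemma biorthogonal_functionals:
  assumes "finite B" "independent B" "B \<subseteq> car N"
  shows "\<exists>f. (\<forall>b\<in>B. f b \<in> car (dual N)) \<and> (\<forall>b\<in>B. \<forall>c\<in>B. f b c = (if b = c then 1 else 0))"
  using assms
proof (induction B)
  case (insert c B)
  interpret dual: normed_space "dual N"
    by (rule normed_dual)
  have cB: "c \<notin> span B" "independent B" "c \<in> car N" "B \<subseteq> car N"
    using insert.prems insert.hyps by (auto simp: independent_insert)
  then obtain f where f: "\<And>b. b \<in> B \<Longrightarrow> f b \<in> car (dual N)"
    and delta: "\<And>a b. \<lbrakk>a \<in> B; b \<in> B\<rbrakk> \<Longrightarrow> f a b = (if a = b then 1 else 0)"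
    using insert.IH by metis
  define c' where "c' = c - (\<Sum>b\<in>B. smul N (f b c) b)"
  have "(\<Sum>b\<in>B. smul N (f b c) b) \<in> span B"
    by (intro span_sum span_scale span_base)
  then have "c' \<noteq> 0"
    using cB by (auto simp: c'_def)
  moreover have sum_car: "(\<Sum>b\<in>B. smul N (f b c) b) \<in> car N"
    using cB by (intro car_sum car_smul) auto
  ultimately obtain g where g: "g \<in> car (dual N)" "g c' \<noteq> 0"
    using separating_functional[of c'] cB car_diff by (auto simp: c'_def)
  define h0 where "h0 = g - (\<Sum>b\<in>B. smul (dual N) (g b) (f b))"
  have h0: "h0 \<in> car (dual N)"
    unfolding h0_def using g f by (intro dual.car_diff dual.car_sum dual.car_smul)
  have h0_apply: "h0 x = g x - (\<Sum>b\<in>B. g b * f b x)" for x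
    by (simp add: h0_def sum_apply dual_sel)
  have h0_B: "h0 b = 0" if "b \<in> B" for b
  proof -
    have "(\<Sum>a\<in>B. g a * f a b) = (\<Sum>a\<in>B. if a = b then g a else 0)"
      using that delta by (intro sum.cong) auto
    then show ?thesis
      using that insert.hyps(1) by (simp add: h0_apply)
  qed
  have "g c' = g c - (\<Sum>b\<in>B. g (smul N (f b c) b))"
    unfolding c'_def using cB sum_car
    by (subst dual_diff[OF g(1)]) (auto intro!: dual_sum[OF g(1)] car_smul)
  also have "\<dots> = h0 c"
    using cB dual_smul[OF g(1)] by (auto simp: h0_apply mult.commute intro!: sum.cong)
  finally have "h0 c \<noteq> 0"
    using g(2) by simp
  define h where "h = smul (dual N) (1 / h0 c) h0"
  have h: "h \<in> car (dual N)"
    unfolding h_def by (intro dual.car_smul h0)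
  have h_B: "h c = 1" "\<And>b. b \<in> B \<Longrightarrow> h b = 0"
    using h0_B \<open>h0 c \<noteq> 0\<close> by (simp_all add: h_def dual_sel(2))
  define f' where "f' b = (if b = c then h else f b - smul (dual N) (f b c) h)" for b
  have "f' b \<in> car (dual N)" if "b \<in> insert c B" for b
    using that f h dual.car_diff dual.car_smul by (auto simp: f'_def)
  moreover have "f' a b = (if a = b then 1 else 0)" if "a \<in> insert c B" "b \<in> insert c B" for a b
    using that h_B delta \<open>c \<notin> B\<close> by (auto simp: f'_def dual_sel(2))
  ultimately show ?case
    by blast
qed simp

text \<open>
  A basis of \<open>V \<inter> car N\<close> is extended to a basis of the space. A vector of \<open>V\<close> has only coordinates
  in the first part, so that the coordinate functionals of the basis vectors outside \<open>V\<close> annihilate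
  \<open>V\<close>. For such a \<open>b\<close>, the rank-one operators \<open>e \<mapsto> f b e \<cdot> x\<close> map \<open>V\<close> into every subspace,
  whatever \<open>x\<close> is; for \<open>b \<in> V\<close> they map \<open>V\<close> into a subspace as soon as it contains \<open>x\<close>.
\<close>

lemma adapted_basis:
  assumes "finite_dimensional_space N" "subspace V"
  obtains B f where "finite B" "B \<subseteq> car N" "\<And>b. b \<in> B \<Longrightarrow> f b \<in> car (dual N)"
    and "\<And>b c. \<lbrakk>b \<in> B; c \<in> B\<rbrakk> \<Longrightarrow> f b c = (if b = c then 1 else 0)"
    and "\<And>x. x \<in> car N \<Longrightarrow> x = (\<Sum>b\<in>B. smul N (f b x) b)"
    and "\<And>b x. \<lbrakk>b \<in> B; b \<notin> V; x \<in> V\<rbrakk> \<Longrightarrow> f b x = 0"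
proof -
  obtain D where D: "finite D" "span D = car N"
    using assms(1) by (auto simp: finite_dimensional_space_def)
  obtain B0 where B0: "B0 \<subseteq> V \<inter> car N" "independent B0" "V \<inter> car N \<subseteq> span B0"
    using maximal_independent_subset by blast
  obtain B where B: "B0 \<subseteq> B" "B \<subseteq> car N" "independent B" "car N \<subseteq> span B"
    using maximal_independent_subset_extend[of B0 "car N"] B0 by auto
  have "finite B"
    using independent_span_bound[OF D(1) B(3)] B(2) D(2) by simp
  then obtain f where f: "\<And>b. b \<in> B \<Longrightarrow> f b \<in> car (dual N)"
    and delta: "\<And>b c. \<lbrakk>b \<in> B; c \<in> B\<rbrakk> \<Longrightarrow> f b c = (if b = c then 1 else 0)"
    using biorthogonal_functionals[OF \<open>finite B\<close> B(3,2)] by metis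
  have coeff: "f b (\<Sum>c\<in>C. smul N (u c) c) = (if b \<in> C then u b else 0)"
    if "b \<in> B" "C \<subseteq> B" for b C u
  proof -
    have "finite C"
      using that(2) \<open>finite B\<close> finite_subset by blast
    have "f b (\<Sum>c\<in>C. smul N (u c) c) = (\<Sum>c\<in>C. u c * f b c)"
      using that B(2) dual_smul[OF f[OF that(1)]]
      by (subst dual_sum[OF f[OF that(1)]]) (auto intro!: car_smul sum.cong)
    also have "\<dots> = (\<Sum>c\<in>C. if b = c then u b else 0)"
      using that delta by (intro sum.cong) auto
    finally show ?thesis
      using \<open>finite C\<close> by simp
  qed
  show thesis
  proof (rule that[of B f, OF \<open>finite B\<close> B(2) f delta])
    show "x = (\<Sum>b\<in>B. smul N (f b x) b)" if x: "x \<in> car N" for x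
    proof -
      obtain u where u: "x = (\<Sum>b\<in>B. smul N (u b) b)"
        using x B(4) unfolding span_finite[OF \<open>finite B\<close>] by blast
      then have "f b x = u b" if "b \<in> B" for b
        using coeff[OF that order_refl] that by simp
      then have "(\<Sum>b\<in>B. smul N (f b x) b) = (\<Sum>b\<in>B. smul N (u b) b)"
        by (intro sum.cong) auto
      with u show ?thesis
        by simp
    qed
    show "f b x = 0" if bx: "b \<in> B" "b \<notin> V" "x \<in> V" for b x
    proof (cases "x \<in> car N")
      case True
      have "finite B0"
        using B(1) \<open>finite B\<close> finite_subset by blast
      then obtain u where "x = (\<Sum>b\<in>B0. smul N (u b) b)"
        using True bx(3) B0(3) unfolding span_finite[OF \<open>finite B0\<close>] by blast
      moreover have "b \<notin> B0"
        using bx B0(1) by blast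
      ultimately show ?thesis
        using coeff[OF bx(1) B(1)] by simp
    next
      case False
      then show ?thesis
        using dual_outside[OF f[OF bx(1)]] by simp
    qed
  qed auto
qed

text \<open>
  Coordinates are bounded on the unit ball; the net consists of the vectors whose coordinates are
  taken from a finite net of a ball of scalars. A vector of the net that is \<open>\<delta>\<close>-close to the unit
  ball has norm at most \<open>1 + \<delta>\<close>, and the others are discarded.
\<close>

lemma unit_ball_finite_net:
  assumes "finite_dimensional_space N" "\<delta> > 0"
  obtains A where "finite A" "A \<subseteq> car N" "\<And>a. a \<in> A \<Longrightarrow> nrm N a \<le> 1 + \<delta>"
    and "\<And>x. \<lbrakk>x \<in> car N; nrm N x \<le> 1\<rbrakk> \<Longrightarrow> \<exists>a\<in>A. nrm N (x - a) \<le> \<delta>"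
proof -
  interpret dual: normed_space "dual N"
    by (rule normed_dual)
  obtain B f where B: "finite B" "B \<subseteq> car N" and f: "\<And>b. b \<in> B \<Longrightarrow> f b \<in> car (dual N)"
    and expand: "\<And>x. x \<in> car N \<Longrightarrow> x = (\<Sum>b\<in>B. smul N (f b x) b)"
    by (rule adapted_basis[OF assms(1) subspace_single_0]) (rule that)
  define K where "K = (\<Sum>b\<in>B. nrm (dual N) (f b))"
  define D where "D = 1 + (\<Sum>b\<in>B. nrm N b)"
  have "D > 0"
    unfolding D_def using B nrm_ge_0 by (intro add_pos_nonneg sum_nonneg) auto
  then have "\<delta> / D > 0"
    using assms by simp
  then obtain Z :: "'k set" where Z: "finite Z" "\<And>z. norm z \<le> K \<Longrightarrow> \<exists>a\<in>Z. norm (z - a) \<le> \<delta> / D"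
    using scalar_ball_finite_net by metis
  define A where "A = {a \<in> (\<lambda>h. \<Sum>b\<in>B. smul N (h b) b) ` (PiE B (\<lambda>_. Z)). nrm N a \<le> 1 + \<delta>}"
  show thesis
  proof (rule that[of A])
    show "finite A"
      using B Z by (simp add: A_def finite_PiE)
    show "A \<subseteq> car N"
      using B by (auto simp: A_def intro!: car_sum car_smul)
    show "nrm N a \<le> 1 + \<delta>" if "a \<in> A" for a
      using that by (simp add: A_def)
    fix x
    assume x: "x \<in> car N" "nrm N x \<le> 1"
    have "\<exists>a\<in>Z. norm (f b x - a) \<le> \<delta> / D" if b: "b \<in> B" for b
    proof (rule Z(2))
      have "norm (f b x) \<le> nrm (dual N) (f b) * nrm N x"
        using dual_apply_le[OF f[OF b] x(1)] .
      also have "\<dots> \<le> nrm (dual N) (f b) * 1"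
        using x(2) dual.nrm_ge_0[OF f[OF b]] by (intro mult_left_mono)
      also have "\<dots> \<le> K"
        unfolding K_def mult_1_right using b B(1) f dual.nrm_ge_0 by (intro member_le_sum) auto
      finally show "norm (f b x) \<le> K" .
    qed
    then obtain h where h: "\<And>b. b \<in> B \<Longrightarrow> h b \<in> Z"
      "\<And>b. b \<in> B \<Longrightarrow> norm (f b x - h b) \<le> \<delta> / D"
      by metis
    define a where "a = (\<Sum>b\<in>B. smul N (h b) b)"
    have a: "a \<in> car N"
      unfolding a_def using B by (intro car_sum car_smul) auto
    have "x - a = (\<Sum>b\<in>B. smul N (f b x - h b) b)"
      using expand[OF x(1)] by (simp add: a_def scale_left_diff_distrib sum_subtractf)
    then have "nrm N (x - a) \<le> (\<Sum>b\<in>B. nrm N (smul N (f b x - h b) b))"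
      using nrm_sum_le[of B "\<lambda>b. smul N (f b x - h b) b"] B car_smul by auto
    also have "\<dots> \<le> (\<Sum>b\<in>B. \<delta> / D * nrm N b)"
    proof (intro sum_mono)
      fix b
      assume "b \<in> B"
      then show "nrm N (smul N (f b x - h b) b) \<le> \<delta> / D * nrm N b"
        using B(2) mult_right_mono[OF h(2) nrm_ge_0[of b]] by (simp add: nrm_smul subset_iff)
    qed
    also have "\<dots> \<le> \<delta> / D * D"
      unfolding sum_distrib_left[symmetric] using \<open>\<delta> / D > 0\<close>
      by (intro mult_left_mono) (simp_all add: D_def)
    also have "\<dots> = \<delta>"
      using \<open>D > 0\<close> by simp
    finally have close: "nrm N (x - a) \<le> \<delta>" .
    have "nrm N a \<le> 1 + \<delta>"
      using nrm_triangle[OF x(1), of "smul N (- 1) (x - a)"] nrm_smul[of "x - a" "- 1"]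
        car_diff[OF x(1) a] close x(2) car_smul[of "x - a" "- 1"] by simp
    moreover have "a \<in> (\<lambda>h. \<Sum>b\<in>B. smul N (h b) b) ` (PiE B (\<lambda>_. Z))"
      using h(1) by (intro image_eqI[of _ _ "restrict h B"]) (auto simp: a_def)
    ultimately show "\<exists>a\<in>A. nrm N (x - a) \<le> \<delta>"
      using close by (auto simp: A_def)
  qed
qed

end

section \<open>Functionals on spaces of operators\<close>

text \<open>
  This is one half of the duality between the maximum norm on finite families and the sum norm on
  the families of functionals. Each norm is nearly attained, at an \<open>x a\<close>; multiplying \<open>x a\<close> by a
  unimodular scalar makes all the values nonnegative, so that nothing cancels in the sum.
\<close>

lemma (in normed_space) sum_dual_nrm_le:
  assumes "finite A" and y: "\<And>a. a \<in> A \<Longrightarrow> y a \<in> car (dual N)"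
    and le: "\<And>x. (\<And>a. a \<in> A \<Longrightarrow> x a \<in> car N \<and> nrm N (x a) \<le> 1) \<Longrightarrow>
      norm (\<Sum>a\<in>A. y a (x a)) \<le> K"
  shows "(\<Sum>a\<in>A. nrm (dual N) (y a)) \<le> K"
proof (rule field_le_epsilon)
  fix \<epsilon> :: real
  assume "\<epsilon> > 0"
  define \<delta> where "\<delta> = \<epsilon> / (real (card A) + 1)"
  have "\<delta> > 0"
    using \<open>\<epsilon> > 0\<close> by (simp add: \<delta>_def)
  have "\<exists>x c. x \<in> car N \<and> nrm N x \<le> 1 \<and> nrm (dual N) (y a) \<le> norm (y a x) + \<delta> \<and>
      norm c = 1 \<and> c * y a x = of_real (norm (y a x))" if a: "a \<in> A" for a
    by (rule dual_nrm_nearly_attained[OF y[OF a] \<open>\<delta> > 0\<close>], rule unimodular_multiple) blast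
  then obtain x c where x: "\<And>a. a \<in> A \<Longrightarrow> x a \<in> car N"
      "\<And>a. a \<in> A \<Longrightarrow> nrm N (x a) \<le> 1"
      "\<And>a. a \<in> A \<Longrightarrow> nrm (dual N) (y a) \<le> norm (y a (x a)) + \<delta>"
    and c: "\<And>a. a \<in> A \<Longrightarrow> norm (c a) = 1"
      "\<And>a. a \<in> A \<Longrightarrow> c a * y a (x a) = of_real (norm (y a (x a)))"
    by metis
  have "(\<Sum>a\<in>A. nrm (dual N) (y a)) \<le> (\<Sum>a\<in>A. norm (y a (x a)) + \<delta>)"
    using x by (intro sum_mono)
  also have "\<dots> = (\<Sum>a\<in>A. norm (y a (x a))) + real (card A) * \<delta>"
    by (simp add: sum.distrib)
  also have "(\<Sum>a\<in>A. norm (y a (x a))) \<le> K"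
  proof -
    have "(\<Sum>a\<in>A. y a (smul N (c a) (x a))) = of_real (\<Sum>a\<in>A. norm (y a (x a)))"
      using x c dual_smul[OF y] by simp
    then have "norm (\<Sum>a\<in>A. y a (smul N (c a) (x a))) = (\<Sum>a\<in>A. norm (y a (x a)))"
      by (simp add: sum_nonneg del: of_real_sum)
    then show ?thesis
      using le[of "\<lambda>a. smul N (c a) (x a)"] x c car_smul nrm_smul by simp
  qed
  also have "real (card A) * \<delta> \<le> \<epsilon>"
    using \<open>\<epsilon> > 0\<close> by (simp add: \<delta>_def field_simps)
  finally show "(\<Sum>a\<in>A. nrm (dual N) (y a)) \<le> K + \<epsilon>"
    by simp
qed

text \<open>
  If the operators in \<open>U\<close> are controlled by their values on the finite set \<open>A\<close>, then restriction to
  \<open>A\<close> embeds \<open>U\<close>, with an inverse of norm at most \<open>C\<close>, into the space of families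
  \<open>A \<rightarrow> car M\<close> with the maximum norm. The functional \<open>\<psi>\<close>, transported to the image of \<open>U\<close>, extends
  to all families by the Hahn--Banach theorem, and a functional on families is a sum of functionals
  of the entries. In this way \<open>\<psi>\<close> is written as \<open>\<Sum>a\<in>A. a \<otimes> y a\<close> with control of the norms. The lemma
  is used with two sets: with a net of the unit ball, where \<open>C\<close> is close to \<open>1\<close>, and with a basis,
  where \<open>C\<close> is merely finite, but the ambiguity of the representation is under control.
\<close>

lemma (in operators) functional_as_sum_of_evaluations:
  fixes U :: "('a \<Rightarrow> 'b) set"
  defines "L \<equiv> (operator_space N M)\<lparr>car := U\<rparr>"
  assumes "finite A" "A \<subseteq> car N"
    and U: "U \<subseteq> bounded_operators N M" "normed_space L"
    and norming: "\<And>S r. \<lbrakk>S \<in> U; 0 \<le> r; \<And>a. a \<in> A \<Longrightarrow> nrm M (S a) \<le> r\<rbrakk> \<Longrightarrow>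
      nrm (operator_space N M) S \<le> C * r"
    and "0 \<le> C"
    and \<psi>: "\<psi> \<in> car (dual L)"
  obtains y where "\<And>a. a \<in> A \<Longrightarrow> y a \<in> car (dual M)"
    and "\<And>S. S \<in> U \<Longrightarrow> \<psi> S = (\<Sum>a\<in>A. y a (S a))"
    and "(\<Sum>a\<in>A. nrm (dual M) (y a)) \<le> C * nrm (dual L) \<psi>"
proof -
  interpret op: normed_space "operator_space N M"
    by (rule normed_operator_space)
  interpret L: normed_space L
    by fact
  interpret dual_L: normed_space "dual L"
    by (rule L.normed_dual)
  have L: "car L = U" "smul L = (\<lambda>c T x. smul M c (T x))" "nrm L = nrm (operator_space N M)"
    by (simp_all add: L_def operator_space_def)
  define s where "s = (\<lambda>c T (x::'a). smul M c (T x))"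
  have vs: "vector_space s"
    using L.vector_space_axioms by (simp add: L s_def)
  interpret fs: vector_space s
    by (fact vs)
  \<comment> \<open>families indexed by \<open>A\<close>, extended by \<open>0\<close>, with their maximum norm \<open>m\<close> and the restriction \<open>R\<close>\<close>
  define V where "V = {g. (\<forall>a\<in>A. g a \<in> car M) \<and> (\<forall>a. a \<notin> A \<longrightarrow> g a = 0)}"
  define m where "m g = Max (insert 0 ((\<lambda>a. nrm M (g a)) ` A))" for g
  define R where "R S a = (if a \<in> A then S a else 0)" for S :: "'a \<Rightarrow> 'b" and a
  have V: "fs.subspace V"
    unfolding fs.subspace_def
    by (simp add: V_def s_def cod.car_0 cod.car_add cod.car_smul)
  have m_ge_0: "0 \<le> m g" and m_ge: "a \<in> A \<Longrightarrow> nrm M (g a) \<le> m g" for g a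
    using \<open>finite A\<close> by (simp_all add: m_def)
  have m_le: "m g \<le> r" if "0 \<le> r" "\<And>a. a \<in> A \<Longrightarrow> nrm M (g a) \<le> r" for g r
    using \<open>finite A\<close> that by (simp add: m_def)
  have m_add: "m (g + h) \<le> m g + m h" if "g \<in> V" "h \<in> V" for g h
  proof (rule m_le)
    show "nrm M ((g + h) a) \<le> m g + m h" if "a \<in> A" for a
      using cod.nrm_triangle[of "g a" "h a"] m_ge[OF that, of g] m_ge[OF that, of h]
        \<open>g \<in> V\<close> \<open>h \<in> V\<close> that by (simp add: V_def)
  qed (simp add: m_ge_0)
  have m_scale: "m (s c g) = norm c * m g" if "g \<in> V" for c g
  proof (rule homogeneous_if_le[OF vs fs.subspace_scale[OF V] _ m_ge_0 that])
    show "m (s c g) \<le> norm c * m g" if "g \<in> V" for c g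
      using that m_ge
      by (intro m_le) (simp_all add: V_def s_def m_ge_0 cod.nrm_smul mult_left_mono)
  qed
  have R_V: "R S \<in> V" if "S \<in> U" for S
    using that U(1) \<open>A \<subseteq> car N\<close> op_car by (auto simp: V_def R_def)
  have R_add: "R (S + T) = R S + R T" and R_scale: "R (s c S) = s c (R S)" for S T c
    by (auto simp: R_def s_def fun_eq_iff)
  have nrm_le_R: "nrm L S \<le> C * m (R S)" if "S \<in> U" for S
    using norming[OF that m_ge_0] m_ge[of _ "R S"] by (simp add: L R_def)
  have "inj_on R U"
  proof (rule inj_onI)
    fix S T
    assume ST: "S \<in> U" "T \<in> U" "R S = R T"
    then have "R (S - T) = 0"
      by (auto simp: R_def fun_eq_iff split: if_splits)
    then have "m (R (S - T)) \<le> 0"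
      by (intro m_le) (simp_all add: cod.nrm_0)
    then have "nrm L (S - T) \<le> 0"
      using nrm_le_R[of "S - T"] L.car_diff ST m_ge_0[of "R (S - T)"] by (simp add: L)
    then show "S = T"
      using L.nrm_eq_0_iff[of "S - T"] L.nrm_ge_0[of "S - T"] L.car_diff ST by (simp add: L)
  qed
  define f where "f g = \<psi> (inv_into U R g)" for g
  have f_R: "f (R S) = \<psi> S" if "S \<in> U" for S
    using \<open>inj_on R U\<close> that by (simp add: f_def)
  have U_add: "S + T \<in> U" if "S \<in> U" "T \<in> U" for S T
    using L.car_add that by (simp add: L)
  have U_scale: "s c S \<in> U" if "S \<in> U" for S c
    using L.car_smul that by (simp add: L s_def)
  have R_subspace: "fs.subspace (R ` U)"
    unfolding fs.subspace_def
  proof (intro conjI ballI allI)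
    show "0 \<in> R ` U"
      using L.car_0 by (intro image_eqI[of _ _ 0]) (simp_all add: L R_def fun_eq_iff)
  qed (use U_add U_scale in \<open>auto simp flip: R_add R_scale\<close>)
  define K where "K = C * nrm (dual L) \<psi>"
  have "0 \<le> K"
    using \<open>0 \<le> C\<close> dual_L.nrm_ge_0[OF \<psi>] by (simp add: K_def)
  obtain G where G_add: "\<And>g h. \<lbrakk>g \<in> V; h \<in> V\<rbrakk> \<Longrightarrow> G (g + h) = G g + G h"
    and G_scale: "\<And>c g. g \<in> V \<Longrightarrow> G (s c g) = c * G g"
    and G_le: "\<And>g. g \<in> V \<Longrightarrow> norm (G g) \<le> K * m g"
    and G_f: "\<And>g. g \<in> R ` U \<Longrightarrow> G g = f g"
  proof (rule hahn_banach[OF vs V R_subspace, of "\<lambda>g. K * m g" f])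
    show "R ` U \<subseteq> V"
      using R_V by blast
    show "K * m (g + h) \<le> K * m g + K * m h" if "g \<in> V" "h \<in> V" for g h
      using mult_left_mono[OF m_add[OF that] \<open>0 \<le> K\<close>] by (simp add: distrib_left)
    show "f (g + h) = f g + f h" if gh: "g \<in> R ` U" "h \<in> R ` U" for g h
    proof -
      obtain S T where "S \<in> U" "T \<in> U" "g = R S" "h = R T"
        using gh by blast
      then show ?thesis
        using L.dual_add[OF \<psi>, of S T] U_add by (simp add: f_R L flip: R_add)
    qed
    show "f (s c g) = c * f g" if g: "g \<in> R ` U" for c g
    proof -
      obtain S where "S \<in> U" "g = R S"
        using g by blast
      then show ?thesis
        using L.dual_smul[OF \<psi>, of S c] U_scale by (simp add: f_R L flip: R_scale s_def)
    qed
    show "norm (f g) \<le> K * m g" if g: "g \<in> R ` U" for g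
    proof -
      obtain S where S: "S \<in> U" "g = R S"
        using g by blast
      have "norm (\<psi> S) \<le> nrm (dual L) \<psi> * nrm L S"
        using L.dual_apply_le[OF \<psi>] S by (simp add: L)
      also have "\<dots> \<le> nrm (dual L) \<psi> * (C * m (R S))"
        using nrm_le_R[OF S(1)] dual_L.nrm_ge_0[OF \<psi>] by (intro mult_left_mono)
      finally show ?thesis
        using S by (simp add: f_R K_def mult.assoc mult.left_commute)
    qed
    show "K * m (s c g) = norm c * (K * m g)" if "g \<in> V" for c g
      using m_scale[OF that] by simp
  qed (rule that)
  define single where "single a x c = (if c = a then x else 0)" for a c :: 'a and x :: 'b
  have single_V: "single a x \<in> V" if "a \<in> A" "x \<in> car M" for a x
    using that by (auto simp: V_def single_def cod.car_0)
  have single_add: "single a (x + y) = single a x + single a y"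
    and single_scale: "single a (smul M c x) = s c (single a x)" for a x y c
    by (auto simp: single_def s_def fun_eq_iff)
  have m_single: "m (single a x) \<le> nrm M x" if "x \<in> car M" for a x
    using cod.nrm_ge_0[OF that] by (intro m_le) (simp_all add: single_def cod.nrm_0)
  have G_0: "G 0 = 0"
    using G_scale[OF fs.subspace_0[OF V], of 0] by simp
  have G_sum: "G (\<Sum>a\<in>B. h a) = (\<Sum>a\<in>B. G (h a))" if "\<And>a. a \<in> B \<Longrightarrow> h a \<in> V"
    for h and B :: "'a set"
    using that
  proof (induction B rule: infinite_finite_induct)
    case (insert a B)
    then show ?case
      using G_add[of "h a" "sum h B"] fs.subspace_sum[OF V, of B h]
      by (simp del: plus_fun_apply)
  qed (simp_all add: G_0)
  define y where "y a x = (if x \<in> car M then G (single a x) else 0)" for a x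
  have y_dual: "y a \<in> car (dual M)" if a: "a \<in> A" for a
  proof (rule cod.dualI)
    show "norm (y a x) \<le> K * nrm M x" if x: "x \<in> car M" for x
      using G_le[OF single_V[OF a x]] mult_left_mono[OF m_single[OF x, of a] \<open>0 \<le> K\<close>] x
      by (simp add: y_def)
  qed (use a in \<open>simp_all add: y_def single_add single_scale G_add G_scale single_V
      cod.car_add cod.car_smul\<close>)
  have sum_y: "(\<Sum>a\<in>A. y a (x a)) = G (\<Sum>a\<in>A. single a (x a))"
    if "\<And>a. a \<in> A \<Longrightarrow> x a \<in> car M" for x
    using that by (subst G_sum) (auto simp: y_def single_V intro!: sum.cong)
  have sum_single: "(\<Sum>a\<in>A. single a (x a)) = (\<lambda>a. if a \<in> A then x a else 0)" for x
    using \<open>finite A\<close> by (simp add: fun_eq_iff sum_apply single_def)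
  show thesis
  proof (rule that[of y, OF y_dual])
    show "\<psi> S = (\<Sum>a\<in>A. y a (S a))" if "S \<in> U" for S
    proof -
      have "(\<Sum>a\<in>A. y a (S a)) = G (R S)"
        using op_car[of S] U(1) that \<open>A \<subseteq> car N\<close>
        by (subst sum_y) (auto simp: sum_single R_def[abs_def])
      then show ?thesis
        using G_f f_R that by simp
    qed
    show "(\<Sum>a\<in>A. nrm (dual M) (y a)) \<le> C * nrm (dual L) \<psi>"
    proof (rule cod.sum_dual_nrm_le[OF \<open>finite A\<close> y_dual])
      fix x
      assume x: "\<And>a. a \<in> A \<Longrightarrow> x a \<in> car M \<and> nrm M (x a) \<le> 1"
      have "(\<Sum>a\<in>A. single a (x a)) \<in> V"
        using x single_V by (intro fs.subspace_sum[OF V]) blast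
      moreover have "m (\<Sum>a\<in>A. single a (x a)) \<le> 1"
        using x by (intro m_le) (simp_all add: sum_single)
      ultimately have "norm (G (\<Sum>a\<in>A. single a (x a))) \<le> K * 1"
        using G_le \<open>0 \<le> K\<close> by (meson mult_left_mono order_trans)
      then show "norm (\<Sum>a\<in>A. y a (x a)) \<le> C * nrm (dual L) \<psi>"
        using sum_y[of x] x by (simp add: K_def)
    qed
  qed
qed

text \<open>
  At a point of the unit ball, \<open>S\<close> differs from its value at a point of the net by at most \<open>\<delta>\<close> times
  its own norm, which can be absorbed in the left-hand side.
\<close>

lemma (in operators) norming_if_net:
  assumes S: "S \<in> bounded_operators N M" and "A \<subseteq> car N" "0 \<le> \<delta>" "\<delta> < 1"
    and net: "\<And>x. \<lbrakk>x \<in> car N; nrm N x \<le> 1\<rbrakk> \<Longrightarrow> \<exists>a\<in>A. nrm N (x - a) \<le> \<delta>"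
    and r: "\<And>a. a \<in> A \<Longrightarrow> nrm M (S a) \<le> r"
  shows "nrm (operator_space N M) S \<le> 1 / (1 - \<delta>) * r"
proof -
  have "nrm (operator_space N M) S \<le> r + nrm (operator_space N M) S * \<delta>"
  proof (rule op_nrm_least)
    fix x
    assume x: "x \<in> car N" "nrm N x \<le> 1"
    obtain a where a: "a \<in> A" "nrm N (x - a) \<le> \<delta>"
      using net[OF x] by blast
    then have "a \<in> car N"
      using \<open>A \<subseteq> car N\<close> by blast
    then have diff: "x - a \<in> car N"
      using x dom.car_diff by blast
    have "S x = S a + S (x - a)"
      using op_add[OF S \<open>a \<in> car N\<close> diff] by simp
    then have "nrm M (S x) \<le> nrm M (S a) + nrm M (S (x - a))"
      using cod.nrm_triangle op_car[OF S] \<open>a \<in> car N\<close> diff by simp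
    also have "nrm M (S (x - a)) \<le> nrm (operator_space N M) S * nrm N (x - a)"
      using op_apply_le[OF S diff] .
    also have "\<dots> \<le> nrm (operator_space N M) S * \<delta>"
      using a(2) op_nrm_ge_0[OF S] by (rule mult_left_mono)
    finally show "nrm M (S x) \<le> r + nrm (operator_space N M) S * \<delta>"
      using r[OF a(1)] by simp
  qed
  then show ?thesis
    using \<open>\<delta> < 1\<close> by (simp add: field_simps)
qed

lemma (in operators) norming_if_coordinates:
  assumes S: "S \<in> bounded_operators N M" and "B \<subseteq> car N"
    and f: "\<And>b. b \<in> B \<Longrightarrow> f b \<in> car (dual N)"
    and expand: "\<And>x. x \<in> car N \<Longrightarrow> x = (\<Sum>b\<in>B. smul N (f b x) b)"
    and "0 \<le> r" and r: "\<And>b. b \<in> B \<Longrightarrow> nrm M (S b) \<le> r"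
  shows "nrm (operator_space N M) S \<le> (\<Sum>b\<in>B. nrm (dual N) (f b)) * r"
proof -
  interpret dual: normed_space "dual N"
    by (rule dom.normed_dual)
  show ?thesis
  proof (rule op_nrm_le)
    fix x
    assume x: "x \<in> car N"
    have car: "smul M (f b x) (S b) \<in> car M" if "b \<in> B" for b
      using that \<open>B \<subseteq> car N\<close> op_car[OF S] cod.car_smul by blast
    have "S x = S (\<Sum>b\<in>B. smul N (f b x) b)"
      using expand[OF x] by simp
    also have "\<dots> = (\<Sum>b\<in>B. S (smul N (f b x) b))"
      using \<open>B \<subseteq> car N\<close> dom.car_smul by (intro op_sum[OF S]) blast
    also have "\<dots> = (\<Sum>b\<in>B. smul M (f b x) (S b))"
      using \<open>B \<subseteq> car N\<close> op_smul[OF S] by (intro sum.cong) auto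
    finally have "nrm M (S x) \<le> (\<Sum>b\<in>B. nrm M (smul M (f b x) (S b)))"
      using cod.nrm_sum_le[OF car] by simp
    also have "\<dots> \<le> (\<Sum>b\<in>B. nrm (dual N) (f b) * nrm N x * r)"
    proof (intro sum_mono)
      fix b
      assume b: "b \<in> B"
      then have "S b \<in> car M"
        using \<open>B \<subseteq> car N\<close> op_car[OF S] by blast
      moreover have "norm (f b x) * nrm M (S b) \<le> nrm (dual N) (f b) * nrm N x * r"
        using dom.dual_apply_le[OF f[OF b] x] r[OF b] cod.nrm_ge_0[OF \<open>S b \<in> car M\<close>]
          dual.nrm_ge_0[OF f[OF b]] dom.nrm_ge_0[OF x]
        by (intro mult_mono) auto
      ultimately show "nrm M (smul M (f b x) (S b)) \<le> nrm (dual N) (f b) * nrm N x * r"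
        using cod.nrm_smul by simp
    qed
    also have "\<dots> = (\<Sum>b\<in>B. nrm (dual N) (f b)) * r * nrm N x"
      by (simp add: sum_distrib_left sum_distrib_right mult_ac)
    finally show "nrm M (S x) \<le> (\<Sum>b\<in>B. nrm (dual N) (f b)) * r * nrm N x" .
  next
    show "0 \<le> (\<Sum>b\<in>B. nrm (dual N) (f b)) * r"
      using dual.nrm_ge_0[OF f] \<open>0 \<le> r\<close> by (simp add: sum_nonneg)
  qed
qed

section \<open>The bidual of a space of subspace-respecting operators\<close>

locale subspace_respecting_operators = operators N M
  for N :: "('k::real_or_complex, 'a::ab_group_add) nspace"
    and M :: "('k, 'b::ab_group_add) nspace" +
  fixes V :: "'a set" and W :: "'b set"
  assumes V: "dom.subspace V" and W: "cod.subspace W"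
begin

abbreviation L where "L \<equiv> pair_operator_space N V M W"
abbreviation P where "P \<equiv> pair_operator_space N V (bidual M) (biannihilator M W)"

sublocale L: normed_space L
  using normed_pair_operator_space[OF W] .
sublocale dual_L: normed_space "dual L"
  using L.normed_dual .
sublocale bidual_L: normed_space "bidual L"
  using dual_L.normed_dual .
sublocale dual_M: normed_space "dual M"
  using cod.normed_dual .
sublocale bidual_M: normed_space "bidual M"
  using dual_M.normed_dual .
sublocale ops_bidual: operators N "bidual M"
  by unfold_locales

lemma L_sel:
  "car L = {S \<in> bounded_operators N M. S ` V \<subseteq> W}"
  "smul L = (\<lambda>c S e. smul M c (S e))" "nrm L = nrm (operator_space N M)"
  by (simp_all add: pair_operator_space_sel operator_space_def)

lemma L_bounded: "S \<in> car L \<Longrightarrow> S \<in> bounded_operators N M"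
  by (simp add: L_sel)

lemma functional_on_L:
  assumes "finite A" "A \<subseteq> car N"
    and "\<And>S r. \<lbrakk>S \<in> car L; 0 \<le> r; \<And>a. a \<in> A \<Longrightarrow> nrm M (S a) \<le> r\<rbrakk> \<Longrightarrow>
      nrm (operator_space N M) S \<le> C * r"
    and "0 \<le> C" "\<psi> \<in> car (dual L)"
  obtains y where "\<And>a. a \<in> A \<Longrightarrow> y a \<in> car (dual M)"
    and "\<And>S. S \<in> car L \<Longrightarrow> \<psi> S = (\<Sum>a\<in>A. y a (S a))"
    and "(\<Sum>a\<in>A. nrm (dual M) (y a)) \<le> C * nrm (dual L) \<psi>"
proof -
  have eq: "(operator_space N M)\<lparr>car := car L\<rparr> = L"
    by (simp add: pair_operator_space_def)
  have "car L \<subseteq> bounded_operators N M"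
    using L_bounded by blast
  then show thesis
    using functional_as_sum_of_evaluations[of A "car L" C \<psi>, unfolded eq,
        OF assms(1,2) _ L.normed_space_axioms assms(3-5)] that
    by blast
qed

lemma tensor_apply: "S \<in> car L \<Longrightarrow> tensor_functional L e f S = f (S e)"
  by (simp add: tensor_functional_def)

context
  fixes e f
  assumes e: "e \<in> car N" and f: "f \<in> car (dual M)"
begin

lemma tensor_apply_le:
  assumes "S \<in> car L"
  shows "norm (tensor_functional L e f S) \<le> nrm N e * nrm (dual M) f * nrm L S"
proof -
  have "norm (f (S e)) \<le> nrm (dual M) f * nrm M (S e)"
    using cod.dual_apply_le[OF f] op_car[OF L_bounded[OF assms] e] .
  also have "\<dots> \<le> nrm (dual M) f * (nrm L S * nrm N e)"
    using op_apply_le[OF L_bounded[OF assms] e] dual_M.nrm_ge_0[OF f]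
    by (simp add: L_sel mult_left_mono)
  finally show ?thesis
    using assms by (simp add: tensor_apply mult_ac)
qed

lemma tensor_dual: "tensor_functional L e f \<in> car (dual L)"
proof (rule L.dualI[OF _ _ tensor_apply_le])
  show "tensor_functional L e f (S + T) = tensor_functional L e f S + tensor_functional L e f T"
    if "S \<in> car L" "T \<in> car L" for S T
    using that L.car_add cod.dual_add[OF f] op_car[OF L_bounded e] by (simp add: tensor_apply)
  show "tensor_functional L e f (smul L c S) = c * tensor_functional L e f S"
    if "S \<in> car L" for c S
    using that L.car_smul[of S c] cod.dual_smul[OF f] op_car[OF L_bounded e]
    by (simp add: tensor_apply) (simp add: L_sel)
qed (simp_all add: tensor_functional_def)

lemma tensor_nrm_le: "nrm (dual L) (tensor_functional L e f) \<le> nrm N e * nrm (dual M) f"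
  using tensor_apply_le dom.nrm_ge_0[OF e] dual_M.nrm_ge_0[OF f] by (intro L.dual_nrm_le) auto

end

lemma tensor_add_left:
  assumes "e \<in> car N" "e' \<in> car N" "f \<in> car (dual M)"
  shows "tensor_functional L (e + e') f = tensor_functional L e f + tensor_functional L e' f"
  using assms op_add[OF L_bounded] op_car[OF L_bounded] cod.dual_add
  by (simp add: tensor_functional_def fun_eq_iff)

lemma tensor_smul_left:
  assumes "e \<in> car N" "f \<in> car (dual M)"
  shows "tensor_functional L (smul N c e) f = smul (dual L) c (tensor_functional L e f)"
  using assms op_smul[OF L_bounded] op_car[OF L_bounded] cod.dual_smul
  by (simp add: tensor_functional_def fun_eq_iff dual_sel)

lemma tensor_add_right:
  "tensor_functional L e (f + g) = tensor_functional L e f + tensor_functional L e g"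
  by (simp add: tensor_functional_def fun_eq_iff)

lemma tensor_smul_right:
  "tensor_functional L e (smul (dual M) c f) = smul (dual L) c (tensor_functional L e f)"
  by (simp add: tensor_functional_def fun_eq_iff dual_sel)

lemma tensor_annihilator:
  assumes "e \<in> V" "f \<in> annihilator M W"
  shows "tensor_functional L e f = 0"
  using assms by (auto simp: tensor_functional_def fun_eq_iff annihilator_def L_sel)

lemma tilde_add: "tilde N M L (\<phi> + \<phi>') = tilde N M L \<phi> + tilde N M L \<phi>'"
  by (simp add: tilde_def fun_eq_iff)

lemma tilde_smul: "tilde N M L (smul (bidual L) c \<phi>) = smul P c (tilde N M L \<phi>)"
  by (simp add: tilde_def fun_eq_iff pair_operator_space_sel operator_space_def dual_sel)

context
  fixes \<phi>
  assumes \<phi>: "\<phi> \<in> car (bidual L)"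
begin

lemma tilde_apply:
  "\<lbrakk>e \<in> car N; f \<in> car (dual M)\<rbrakk> \<Longrightarrow> tilde N M L \<phi> e f = \<phi> (tensor_functional L e f)"
  by (simp add: tilde_def)

lemma tilde_apply_le:
  assumes e: "e \<in> car N" and f: "f \<in> car (dual M)"
  shows "norm (tilde N M L \<phi> e f) \<le> nrm (bidual L) \<phi> * nrm N e * nrm (dual M) f"
proof -
  have "norm (\<phi> (tensor_functional L e f))
      \<le> nrm (bidual L) \<phi> * nrm (dual L) (tensor_functional L e f)"
    using dual_L.dual_apply_le[OF \<phi> tensor_dual[OF e f]] .
  also have "\<dots> \<le> nrm (bidual L) \<phi> * (nrm N e * nrm (dual M) f)"
    using tensor_nrm_le[OF e f] bidual_L.nrm_ge_0[OF \<phi>] by (rule mult_left_mono)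
  finally show ?thesis
    by (simp add: tilde_apply[OF e f] mult.assoc)
qed

lemma tilde_bidual:
  assumes e: "e \<in> car N"
  shows "tilde N M L \<phi> e \<in> car (bidual M)"
proof (rule dual_M.dualI[OF _ _ tilde_apply_le[OF e]])
  show "tilde N M L \<phi> e (f + g) = tilde N M L \<phi> e f + tilde N M L \<phi> e g"
    if "f \<in> car (dual M)" "g \<in> car (dual M)" for f g
    using that e dual_M.car_add dual_L.dual_add[OF \<phi>]
    by (simp add: tilde_apply tensor_add_right tensor_dual)
  show "tilde N M L \<phi> e (smul (dual M) c f) = c * tilde N M L \<phi> e f"
    if "f \<in> car (dual M)" for c f
    using that e dual_M.car_smul dual_L.dual_smul[OF \<phi>]
    by (simp add: tilde_apply tensor_smul_right tensor_dual)
qed (simp_all add: tilde_def)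

lemma tilde_nrm_apply_le:
  assumes e: "e \<in> car N"
  shows "nrm (bidual M) (tilde N M L \<phi> e) \<le> nrm (bidual L) \<phi> * nrm N e"
  using tilde_apply_le[OF e] bidual_L.nrm_ge_0[OF \<phi>] dom.nrm_ge_0[OF e]
  by (intro dual_M.dual_nrm_le) simp_all

lemma tilde_car: "tilde N M L \<phi> \<in> car P"
proof -
  have "tilde N M L \<phi> \<in> bounded_operators N (bidual M)"
  proof (rule ops_bidual.bounded_operatorsI[OF tilde_bidual _ _ tilde_nrm_apply_le])
    show "tilde N M L \<phi> (e + e') = tilde N M L \<phi> e + tilde N M L \<phi> e'"
      if "e \<in> car N" "e' \<in> car N" for e e'
      using that dom.car_add dual_L.dual_add[OF \<phi>]
      by (simp add: tilde_def fun_eq_iff tensor_add_left tensor_dual)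
    show "tilde N M L \<phi> (smul N c e) = smul (bidual M) c (tilde N M L \<phi> e)"
      if "e \<in> car N" for c e
      using that dom.car_smul dual_L.dual_smul[OF \<phi>]
      by (simp add: tilde_def fun_eq_iff tensor_smul_left tensor_dual dual_sel(2))
  qed (simp_all add: tilde_def)
  moreover have "tilde N M L \<phi> e \<in> biannihilator M W" if "e \<in> V" for e
  proof (cases "e \<in> car N")
    case True
    then show ?thesis
      using that tilde_bidual[OF True] dual_L.dual_0[OF \<phi>]
      by (simp add: biannihilator_def annihilator_def[of "dual M"] tilde_def tensor_annihilator)
  next
    case False
    then show ?thesis
      using bidual_M.car_0
      by (simp add: tilde_def biannihilator_def annihilator_def[of "dual M"])
  qed
  ultimately show ?thesis
    by (auto simp: pair_operator_space_sel)
qed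

lemma tilde_nrm_le: "nrm P (tilde N M L \<phi>) \<le> nrm (bidual L) \<phi>"
  unfolding pair_operator_space_sel
  using tilde_nrm_apply_le bidual_L.nrm_ge_0[OF \<phi>] by (intro ops_bidual.op_nrm_le)

text \<open>
  This is the half of the isometry that needs finite dimension. On a \<open>\<delta>\<close>-net of the unit ball, a
  functional \<open>\<psi>\<close> is \<open>\<Sum>a\<in>A. a \<otimes> y a\<close> with \<open>\<Sum>a\<in>A. \<parallel>y a\<parallel> \<le> \<parallel>\<psi>\<parallel> / (1 - \<delta>)\<close>. Since \<open>\<phi>\<close> is
  determined on elementary tensors by its transform, \<open>\<parallel>\<phi>\<parallel>\<close> is at most \<open>(1 + \<delta>) / (1 - \<delta>)\<close> times
  the norm of the transform, for every \<open>\<delta>\<close>.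
\<close>

lemma nrm_le_tilde:
  assumes "finite_dimensional_space N"
  shows "nrm (bidual L) \<phi> \<le> nrm P (tilde N M L \<phi>)"
proof -
  define t where "t = nrm P (tilde N M L \<phi>)"
  have bounded: "tilde N M L \<phi> \<in> bounded_operators N (bidual M)"
    using tilde_car by (simp add: pair_operator_space_sel)
  have "0 \<le> t"
    unfolding t_def pair_operator_space_sel using ops_bidual.op_nrm_ge_0[OF bounded] .
  have approx: "(1 - \<delta>) * nrm (bidual L) \<phi> \<le> (1 + \<delta>) * t" if \<delta>: "0 < \<delta>" "\<delta> < 1" for \<delta>
  proof -
    obtain A where A: "finite A" "A \<subseteq> car N" "\<And>a. a \<in> A \<Longrightarrow> nrm N a \<le> 1 + \<delta>"
      and net: "\<And>x. \<lbrakk>x \<in> car N; nrm N x \<le> 1\<rbrakk> \<Longrightarrow> \<exists>a\<in>A. nrm N (x - a) \<le> \<delta>"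
      by (rule dom.unit_ball_finite_net[OF assms \<delta>(1)]) (rule that)
    define C where "C = 1 / (1 - \<delta>)"
    have "0 \<le> C"
      using \<delta> by (simp add: C_def)
    have "nrm (bidual L) \<phi> \<le> (1 + \<delta>) * t * C"
    proof (rule dual_L.dual_nrm_le)
      fix \<psi>
      assume \<psi>: "\<psi> \<in> car (dual L)"
      obtain y where y: "\<And>a. a \<in> A \<Longrightarrow> y a \<in> car (dual M)"
        and \<psi>_eq: "\<And>S. S \<in> car L \<Longrightarrow> \<psi> S = (\<Sum>a\<in>A. y a (S a))"
        and y_le: "(\<Sum>a\<in>A. nrm (dual M) (y a)) \<le> C * nrm (dual L) \<psi>"
      proof (rule functional_on_L[OF A(1,2) _ \<open>0 \<le> C\<close> \<psi>])
        show "nrm (operator_space N M) S \<le> C * r"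
          if "S \<in> car L" "0 \<le> r" "\<And>a. a \<in> A \<Longrightarrow> nrm M (S a) \<le> r" for S r
          unfolding C_def using \<delta> that A net L_bounded by (intro norming_if_net) auto
      qed (rule that)
      have "\<psi> = (\<Sum>a\<in>A. tensor_functional L a (y a))"
      proof (rule ext)
        fix S
        show "\<psi> S = (\<Sum>a\<in>A. tensor_functional L a (y a)) S"
          using \<psi>_eq[of S] L.dual_outside[OF \<psi>, of S]
          by (cases "S \<in> car L") (simp_all add: sum_apply tensor_functional_def)
      qed
      then have "\<phi> \<psi> = (\<Sum>a\<in>A. \<phi> (tensor_functional L a (y a)))"
        using dual_L.dual_sum[OF \<phi>, of A "\<lambda>a. tensor_functional L a (y a)"] A(2) y tensor_dual
        by auto
      also have "\<dots> = (\<Sum>a\<in>A. tilde N M L \<phi> a (y a))"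
        using A(2) y by (intro sum.cong) (auto simp: tilde_apply)
      also have "norm \<dots> \<le> (\<Sum>a\<in>A. (1 + \<delta>) * t * nrm (dual M) (y a))"
      proof (intro sum_norm_le)
        fix a
        assume a: "a \<in> A"
        then have a_car: "a \<in> car N"
          using A(2) by blast
        have "nrm (bidual M) (tilde N M L \<phi> a) \<le> t * nrm N a"
          unfolding t_def pair_operator_space_sel using ops_bidual.op_apply_le[OF bounded a_car] .
        also have "\<dots> \<le> t * (1 + \<delta>)"
          using A(3)[OF a] \<open>0 \<le> t\<close> by (rule mult_left_mono)
        finally have "nrm (bidual M) (tilde N M L \<phi> a) * nrm (dual M) (y a)
            \<le> t * (1 + \<delta>) * nrm (dual M) (y a)"
          using dual_M.nrm_ge_0[OF y[OF a]] by (rule mult_right_mono)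
        then show "norm (tilde N M L \<phi> a (y a)) \<le> (1 + \<delta>) * t * nrm (dual M) (y a)"
          using dual_M.dual_apply_le[OF tilde_bidual[OF a_car] y[OF a]] by (simp add: mult_ac)
      qed
      also have "\<dots> = (1 + \<delta>) * t * (\<Sum>a\<in>A. nrm (dual M) (y a))"
        by (simp add: sum_distrib_left)
      also have "\<dots> \<le> (1 + \<delta>) * t * (C * nrm (dual L) \<psi>)"
        using y_le \<delta> \<open>0 \<le> t\<close> by (intro mult_left_mono) auto
      finally show "norm (\<phi> \<psi>) \<le> (1 + \<delta>) * t * C * nrm (dual L) \<psi>"
        by (simp add: mult.assoc)
    qed (use \<delta> \<open>0 \<le> t\<close> \<open>0 \<le> C\<close> in simp)
    then show ?thesis
      using \<delta> by (simp add: C_def field_simps)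
  qed
  show ?thesis
  proof (rule ccontr)
    assume "\<not> ?thesis"
    then have less: "t < nrm (bidual L) \<phi>"
      by (simp add: t_def)
    \<comment> \<open>half the value of \<open>\<delta>\<close> at which \<open>approx\<close> would be an equality\<close>
    define \<delta> where "\<delta> = (nrm (bidual L) \<phi> - t) / 2 / (nrm (bidual L) \<phi> + t)"
    have "0 < \<delta>" "\<delta> < 1"
      using less \<open>0 \<le> t\<close> by (simp_all add: \<delta>_def)
    then have "nrm (bidual L) \<phi> - t \<le> \<delta> * (nrm (bidual L) \<phi> + t)"
      using approx by (force simp: algebra_simps)
    also have "\<dots> = (nrm (bidual L) \<phi> - t) / 2"
    proof -
      have "nrm (bidual L) \<phi> + t \<noteq> 0"
        using less \<open>0 \<le> t\<close> by simp
      then show ?thesis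
        using nonzero_eq_divide_eq \<delta>_def by blast
    qed
    finally show False
      using less by simp
  qed
qed

end

text \<open>
  Every \<open>\<psi>\<close> has the form \<open>\<Sum>b\<in>B. b \<otimes> y b\<close> for a basis \<open>B\<close> adapted to \<open>V\<close>, which forces
  \<open>\<phi> \<psi> = (\<Sum>b\<in>B. T b (y b))\<close>. The family \<open>y\<close> is not unique, since the \<open>y b\<close> with \<open>b \<in> V\<close> are only
  determined on \<open>W\<close>; but \<open>T b\<close> lies in the biannihilator of \<open>W\<close> for exactly these \<open>b\<close>, and therefore
  \<open>T b (y b)\<close> does not depend on the choice.
\<close>

lemma tilde_surjective:
  assumes "finite_dimensional_space N" and T: "T \<in> car P"
  obtains \<phi> where "\<phi> \<in> car (bidual L)" "tilde N M L \<phi> = T"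
proof -
  have T_bounded: "T \<in> bounded_operators N (bidual M)"
    and T_V: "\<And>e. e \<in> V \<Longrightarrow> T e \<in> biannihilator M W"
    using T by (auto simp: pair_operator_space_sel)
  obtain B \<beta> where B: "finite B" "B \<subseteq> car N"
    and \<beta>: "\<And>b. b \<in> B \<Longrightarrow> \<beta> b \<in> car (dual N)"
    and delta: "\<And>b c. \<lbrakk>b \<in> B; c \<in> B\<rbrakk> \<Longrightarrow> \<beta> b c = (if b = c then 1 else 0)"
    and expand: "\<And>x. x \<in> car N \<Longrightarrow> x = (\<Sum>b\<in>B. smul N (\<beta> b x) b)"
    and \<beta>_V: "\<And>b x. \<lbrakk>b \<in> B; b \<notin> V; x \<in> V\<rbrakk> \<Longrightarrow> \<beta> b x = 0"
    by (rule dom.adapted_basis[OF assms(1) V]) (rule that)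
  have T_car: "T b \<in> car (bidual M)" if "b \<in> B" for b
    using that B(2) ops_bidual.op_car[OF T_bounded] by blast
  define represents where "represents y \<psi> \<longleftrightarrow> (\<forall>b\<in>B. y b \<in> car (dual M)) \<and>
      (\<forall>S\<in>car L. \<psi> S = (\<Sum>b\<in>B. y b (S b)))" for y \<psi>
  have unique: "T b (y b) = T b (y' b)"
    if y: "represents y \<psi>" "represents y' \<psi>" and b: "b \<in> B" for y y' \<psi> b
  proof -
    define z where "z = y b - y' b"
    have z: "z \<in> car (dual M)"
      unfolding z_def using y b by (intro dual_M.car_diff) (auto simp: represents_def)
    have z_0: "z x = 0" if x: "x \<in> car M" "b \<in> V \<Longrightarrow> x \<in> W" for x
    proof -
      \<comment> \<open>The operator \<open>e \<mapsto> \<beta> b e \<cdot> x\<close> respects the subspaces and evaluates a representing family at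
         the entry \<open>b\<close> and the vector \<open>x\<close>.\<close>
      define S where "S e = (if e \<in> car N then smul M (\<beta> b e) x else 0)" for e
      have "S \<in> bounded_operators N M"
      proof (rule bounded_operatorsI)
        show "nrm M (S e) \<le> nrm (dual N) (\<beta> b) * nrm M x * nrm N e" if e: "e \<in> car N" for e
          using mult_right_mono[OF dom.dual_apply_le[OF \<beta>[OF b] e] cod.nrm_ge_0[OF x(1)]] e
          by (simp add: S_def cod.nrm_smul[OF x(1)] mult_ac)
      qed (use x(1) dom.dual_add[OF \<beta>[OF b]] dom.dual_smul[OF \<beta>[OF b]] in
          \<open>simp_all add: S_def cod.car_smul dom.car_add dom.car_smul cod.scale_left_distrib\<close>)
      moreover have "S e \<in> W" if "e \<in> V" for e
      proof (cases "b \<in> V")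
        case True
        then show ?thesis
          using x(2) cod.subspace_scale[OF W] cod.subspace_0[OF W] by (simp add: S_def)
      next
        case False
        then show ?thesis
          using \<beta>_V[OF b False that] cod.subspace_0[OF W] by (simp add: S_def)
      qed
      ultimately have S: "S \<in> car L"
        by (auto simp: L_sel)
      have eval: "(\<Sum>c\<in>B. w c (S c)) = w b x" if w: "\<And>c. c \<in> B \<Longrightarrow> w c \<in> car (dual M)" for w
      proof -
        have "(\<Sum>c\<in>B. w c (S c)) = (\<Sum>c\<in>B. if c = b then w c x else 0)"
          using w delta[OF b] B(2) cod.dual_0 by (intro sum.cong) (auto simp: S_def)
        then show ?thesis
          using B(1) b by simp
      qed
      have "y b x = y' b x"
        using y S eval[of y] eval[of y'] by (simp add: represents_def)
      then show ?thesis
        by (simp add: z_def)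
    qed
    have "T b z = 0"
    proof (cases "b \<in> V")
      case True
      have "z \<in> annihilator M W"
        using z z_0 cod.dual_outside[OF z] by (auto simp: annihilator_def)
      then show ?thesis
        using T_V[OF True] by (simp add: biannihilator_def annihilator_def[of "dual M"])
    next
      case False
      then have "z = 0"
        using z_0 cod.dual_outside[OF z] by (fastforce simp: fun_eq_iff)
      then show ?thesis
        using dual_M.dual_0[OF T_car[OF b]] by simp
    qed
    moreover have "T b z = T b (y b) - T b (y' b)"
      unfolding z_def using y b by (intro dual_M.dual_diff[OF T_car]) (auto simp: represents_def)
    ultimately show ?thesis
      by simp
  qed
  define C where "C = (\<Sum>b\<in>B. nrm (dual N) (\<beta> b))"
  interpret dual_N: normed_space "dual N"
    by (rule dom.normed_dual)
  have "0 \<le> C"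
    unfolding C_def using dual_N.nrm_ge_0 \<beta> by (intro sum_nonneg) blast
  have "\<exists>y. represents y \<psi> \<and> (\<Sum>b\<in>B. nrm (dual M) (y b)) \<le> C * nrm (dual L) \<psi>"
    if \<psi>: "\<psi> \<in> car (dual L)" for \<psi>
  proof (rule functional_on_L[OF B _ \<open>0 \<le> C\<close> \<psi>])
    show "nrm (operator_space N M) S \<le> C * r"
      if "S \<in> car L" "0 \<le> r" "\<And>b. b \<in> B \<Longrightarrow> nrm M (S b) \<le> r" for S r
      unfolding C_def using that B \<beta> expand L_bounded by (intro norming_if_coordinates) auto
  qed (auto simp: represents_def)
  then obtain Y where Y: "\<And>\<psi>. \<psi> \<in> car (dual L) \<Longrightarrow> represents (Y \<psi>) \<psi>"
    and Y_le: "\<And>\<psi>. \<psi> \<in> car (dual L) \<Longrightarrow>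
      (\<Sum>b\<in>B. nrm (dual M) (Y \<psi> b)) \<le> C * nrm (dual L) \<psi>"
    by metis
  have Y_dual: "Y \<psi> b \<in> car (dual M)" if "\<psi> \<in> car (dual L)" "b \<in> B" for \<psi> b
    using Y that by (simp add: represents_def)
  define \<phi> where "\<phi> \<psi> = (if \<psi> \<in> car (dual L) then \<Sum>b\<in>B. T b (Y \<psi> b) else 0)" for \<psi>
  have \<phi>_eq: "\<phi> \<psi> = (\<Sum>b\<in>B. T b (y b))" if "\<psi> \<in> car (dual L)" "represents y \<psi>" for y \<psi>
    using that unique[OF Y[OF that(1)] that(2)] by (simp add: \<phi>_def)
  define t where "t = (\<Sum>b\<in>B. nrm (bidual M) (T b))"
  have "0 \<le> t"
    unfolding t_def using bidual_M.nrm_ge_0 T_car by (intro sum_nonneg) blast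
  have \<phi>: "\<phi> \<in> car (bidual L)"
  proof (rule dual_L.dualI)
    fix \<psi> \<psi>'
    assume \<psi>: "\<psi> \<in> car (dual L)" "\<psi>' \<in> car (dual L)"
    have "represents (\<lambda>b. Y \<psi> b + Y \<psi>' b) (\<psi> + \<psi>')"
      using Y[OF \<psi>(1)] Y[OF \<psi>(2)] dual_M.car_add by (simp add: represents_def sum.distrib)
    then have "\<phi> (\<psi> + \<psi>') = (\<Sum>b\<in>B. T b (Y \<psi> b + Y \<psi>' b))"
      using \<phi>_eq dual_L.car_add \<psi> by blast
    also have "\<dots> = (\<Sum>b\<in>B. T b (Y \<psi> b) + T b (Y \<psi>' b))"
      using dual_M.dual_add[OF T_car] Y_dual \<psi> by (intro sum.cong) auto
    finally show "\<phi> (\<psi> + \<psi>') = \<phi> \<psi> + \<phi> \<psi>'"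
      using \<psi> by (simp add: \<phi>_def sum.distrib)
  next
    fix c \<psi>
    assume \<psi>: "\<psi> \<in> car (dual L)"
    have "represents (\<lambda>b. smul (dual M) c (Y \<psi> b)) (smul (dual L) c \<psi>)"
      using Y[OF \<psi>] dual_M.car_smul
      by (simp add: represents_def) (simp add: dual_sel(2) sum_distrib_left)
    then have "\<phi> (smul (dual L) c \<psi>) = (\<Sum>b\<in>B. T b (smul (dual M) c (Y \<psi> b)))"
      using \<phi>_eq dual_L.car_smul \<psi> by blast
    also have "\<dots> = (\<Sum>b\<in>B. c * T b (Y \<psi> b))"
      using dual_M.dual_smul[OF T_car] Y_dual \<psi> by (intro sum.cong) auto
    finally show "\<phi> (smul (dual L) c \<psi>) = c * \<phi> \<psi>"
      using \<psi> by (simp add: \<phi>_def sum_distrib_left)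
  next
    fix \<psi>
    assume \<psi>: "\<psi> \<in> car (dual L)"
    have "norm (\<phi> \<psi>) \<le> (\<Sum>b\<in>B. t * nrm (dual M) (Y \<psi> b))"
      unfolding \<phi>_def if_P[OF \<psi>]
    proof (intro sum_norm_le)
      fix b
      assume b: "b \<in> B"
      have "nrm (bidual M) (T b) \<le> t"
        unfolding t_def using b B(1) T_car bidual_M.nrm_ge_0 by (intro member_le_sum) auto
      then have "nrm (bidual M) (T b) * nrm (dual M) (Y \<psi> b) \<le> t * nrm (dual M) (Y \<psi> b)"
        using dual_M.nrm_ge_0[OF Y_dual[OF \<psi> b]] by (rule mult_right_mono)
      then show "norm (T b (Y \<psi> b)) \<le> t * nrm (dual M) (Y \<psi> b)"
        using dual_M.dual_apply_le[OF T_car[OF b] Y_dual[OF \<psi> b]] by simp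
    qed
    also have "\<dots> \<le> t * (C * nrm (dual L) \<psi>)"
      unfolding sum_distrib_left[symmetric] using Y_le[OF \<psi>] \<open>0 \<le> t\<close> by (rule mult_left_mono)
    finally show "norm (\<phi> \<psi>) \<le> t * C * nrm (dual L) \<psi>"
      by (simp add: mult.assoc)
  qed (simp add: \<phi>_def)
  have "tilde N M L \<phi> e f = T e f" if e: "e \<in> car N" and f: "f \<in> car (dual M)" for e f
  proof -
    have b_car: "smul N (\<beta> b e) b \<in> car N" if "b \<in> B" for b
      using that B(2) dom.car_smul by blast
    have apply_e: "F e = (\<Sum>b\<in>B. F (smul N (\<beta> b e) b))"
      if "\<And>g. (\<And>b. b \<in> B \<Longrightarrow> g b \<in> car N) \<Longrightarrow> F (\<Sum>b\<in>B. g b) = (\<Sum>b\<in>B. F (g b))"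
      for F :: "'a \<Rightarrow> 'z::ab_group_add"
      using that[of "\<lambda>b. smul N (\<beta> b e) b"] b_car expand[OF e] by simp
    have "represents (\<lambda>b. smul (dual M) (\<beta> b e) f) (tensor_functional L e f)"
      unfolding represents_def
    proof (intro conjI ballI)
      show "smul (dual M) (\<beta> b e) f \<in> car (dual M)" for b
        using dual_M.car_smul[OF f] .
      fix S
      assume S: "S \<in> car L"
      note S_bounded = L_bounded[OF S]
      have "f (S e) = f (\<Sum>b\<in>B. S (smul N (\<beta> b e) b))"
        by (subst apply_e[of S, OF op_sum[OF S_bounded]]) simp_all
      also have "\<dots> = (\<Sum>b\<in>B. f (S (smul N (\<beta> b e) b)))"
        using op_car[OF S_bounded] b_car by (intro cod.dual_sum[OF f]) blast
      also have "\<dots> = (\<Sum>b\<in>B. \<beta> b e * f (S b))"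
        using op_smul[OF S_bounded] op_car[OF S_bounded] cod.dual_smul[OF f] B(2)
        by (intro sum.cong) auto
      finally show "tensor_functional L e f S = (\<Sum>b\<in>B. smul (dual M) (\<beta> b e) f (S b))"
        using S by (simp add: tensor_apply dual_sel(2))
    qed
    then have "tilde N M L \<phi> e f = (\<Sum>b\<in>B. T b (smul (dual M) (\<beta> b e) f))"
      using \<phi>_eq tensor_dual[OF e f] tilde_apply[OF \<phi> e f] by simp
    also have "\<dots> = (\<Sum>b\<in>B. smul (bidual M) (\<beta> b e) (T b) f)"
      using dual_M.dual_smul[OF T_car f] by (intro sum.cong) (simp_all add: dual_sel(2))
    also have "\<dots> = (\<Sum>b\<in>B. T (smul N (\<beta> b e) b)) f"
      using ops_bidual.op_smul[OF T_bounded] B(2)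
      by (auto simp: sum_apply intro!: sum.cong)
    also have "\<dots> = T e f"
      by (subst apply_e[of T, OF ops_bidual.op_sum[OF T_bounded]]) simp_all
    finally show ?thesis .
  qed
  moreover have "tilde N M L \<phi> e f = T e f" if "e \<notin> car N \<or> f \<notin> car (dual M)" for e f
    using that ops_bidual.op_outside[OF T_bounded, of e] ops_bidual.op_car[OF T_bounded, of e]
      dual_M.dual_outside[of "T e" f] by (auto simp: tilde_def)
  ultimately have "tilde N M L \<phi> = T"
    by (meson ext)
  with \<phi> show thesis
    using that by blast
qed

lemma tilde_isometric_isomorphism:
  assumes "finite_dimensional_space N"
  shows "isometric_isomorphism (bidual L) P (tilde N M L)"
proof -
  have isometry: "nrm P (tilde N M L \<phi>) = nrm (bidual L) \<phi>" if "\<phi> \<in> car (bidual L)" for \<phi>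
    using tilde_nrm_le[OF that] nrm_le_tilde[OF that assms] by simp
  have "inj_on (tilde N M L) (car (bidual L))"
  proof (rule inj_onI)
    fix \<phi> \<phi>'
    assume \<phi>: "\<phi> \<in> car (bidual L)" "\<phi>' \<in> car (bidual L)"
      and eq: "tilde N M L \<phi> = tilde N M L \<phi>'"
    have "tilde N M L (\<phi> - \<phi>') + tilde N M L \<phi>' = tilde N M L \<phi>"
      using tilde_add[of "\<phi> - \<phi>'" \<phi>'] by simp
    then have "tilde N M L (\<phi> - \<phi>') = tilde N M L 0"
      using eq tilde_add[of 0 0] by simp
    then have "nrm (bidual L) (\<phi> - \<phi>') = nrm (bidual L) 0"
      using isometry bidual_L.car_diff[OF \<phi>] bidual_L.car_0 by metis
    then show "\<phi> = \<phi>'"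
      using bidual_L.nrm_eq_0_iff[OF bidual_L.car_diff[OF \<phi>]] bidual_L.nrm_0 by simp
  qed
  moreover have "tilde N M L ` car (bidual L) = car P"
    using tilde_car tilde_surjective[OF assms] by (auto simp: image_iff) metis
  ultimately show ?thesis
    using tilde_add tilde_smul isometry by (simp add: isometric_isomorphism_def bij_betw_def)
qed

end

theorem theorem4p2:
  fixes E1 :: "('k::real_or_complex, 'e::ab_group_add) nspace" and E2 :: "'e set"
    and X1 :: "('k, 'x::ab_group_add) nspace" and X2 :: "'x set"
  assumes "banach_space E1" and "closed_subspace E1 E2"
    and "banach_space X1" and "closed_subspace X1 X2"
    and "finite_dimensional_space E1"
  shows "isometric_isomorphism
    (bidual (pair_operator_space E1 E2 X1 X2))
    (pair_operator_space E1 E2 (bidual X1) (biannihilator X1 X2))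
    (tilde E1 X1 (pair_operator_space E1 E2 X1 X2))"
proof -
  interpret subspace_respecting_operators E1 X1 E2 X2
    using assms(1-4)
    by (simp add: subspace_respecting_operators_def subspace_respecting_operators_axioms_def
        operators_def banach_space_def closed_subspace_def)
  show ?thesis
    using tilde_isometric_isomorphism[OF assms(5)] .
qed

end
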